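(* Let $A_1,\dots,A_m,B$ be real symmetric $n\times n$ matrices such that the semidefinite system $$(P_{SD})\qquad \sum_{i=1}^m x_iA_i\preceq B$$ is feasible, and suppose that for some $0\le r\le n$ the matrix $Z=\begin{pmatrix} I_r&0\\0&0\end{pmatrix}$ is a maximum rank slack of $(P_{SD})$. Then $(P_{SD})$ is badly behaved if and only if there is a linear combination $V$ of $A_1,\dots,A_m$ of the form $$V=\begin{pmatrix} V_{11}&V_{12}\\ V_{12}^T&V_{22}\end{pmatrix},\quad V_{11}\ \text{is } r\times r,\quad V_{22}\succeq 0,\quad \mathcal R(V_{12}^T)\not\subseteq\mathcal R(V_{22}),$$ where $\mathcal R(\cdot)$ denotes the range space (column space).
   Context: For symmetric matrices $S,T$, $S\preceq T$ means $T-S$ is positive semidefinite (psd), and $S\bullet T:=\operatorname{trace}(ST)$. For $c\in\mathbb R^m$ consider the primal-dual pair $$(\text{SDP-P})\quad \sup\Big\{\sum_{i=1}^m c_ix_i : \sum_{i=1}^m x_iA_i\preceq B\Big\},\qquad (\text{SDP-D})\quad \inf\{B\bullet Y: A_i\bullet Y=c_i\ (i=1,\dots,m),\ Y\succeq 0\}.$$ A feasible system $(P_{SD})$ is badly behaved if there is $c\in\mathbb R^m$ for which the optimal value of (SDP-P) is finite but (SDP-D) has no feasible solution $Y$ whose value $B\bullet Y$ equals it. It is well behaved if it is not badly behaved. A slack of $(P_{SD})$ is a psd matrix of the form $B-\sum_{i=1}^m x_iA_i$ with $x\in\mathbb R^m$; a maximum rank slack is a slack whose rank is largest among all slacks. 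*)

theory Defs
  imports "Jordan_Normal_Form.DL_Rank" "HOL-Library.Extended_Real"
begin

definition mat_trace :: "real mat \<Rightarrow> real" where
  "mat_trace S = (\<Sum>i<dim_row S. S $$ (i, i))"

definition mat_ip :: "real mat \<Rightarrow> real mat \<Rightarrow> real" where
  "mat_ip S T = mat_trace (S * T)"

definition sym_mat :: "nat \<Rightarrow> real mat \<Rightarrow> bool" where
  "sym_mat n S \<longleftrightarrow> S \<in> carrier_mat n n \<and> S\<^sup>T = S"

definition psd_mat :: "nat \<Rightarrow> real mat \<Rightarrow> bool" where
  "psd_mat n S \<longleftrightarrow> sym_mat n S \<and> (\<forall>v\<in>carrier_vec n. 0 \<le> v \<bullet> (S *\<^sub>v v))"

definition loewner_le :: "nat \<Rightarrow> real mat \<Rightarrow> real mat \<Rightarrow> bool" where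
  "loewner_le n S T \<longleftrightarrow> psd_mat n (T - S)"

text \<open>The matrices \<open>A\<^sub>1, \<dots>, A\<^sub>m\<close> are given as \<open>A 0, \<dots>, A (m - 1)\<close>. Matrices of varying
  dimension do not form a type-class monoid, so the sum of the \<open>x\<^sub>k A\<^sub>k\<close> is written entrywise.\<close>

definition mat_lincomb :: "nat \<Rightarrow> nat \<Rightarrow> (nat \<Rightarrow> real mat) \<Rightarrow> real vec \<Rightarrow> real mat" where
  "mat_lincomb n m A x = mat n n (\<lambda>(i, j). \<Sum>k<m. x $ k * A k $$ (i, j))"

definition sdp_feasible_set :: "nat \<Rightarrow> nat \<Rightarrow> (nat \<Rightarrow> real mat) \<Rightarrow> real mat \<Rightarrow> real vec set" where
  "sdp_feasible_set n m A B = {x \<in> carrier_vec m. loewner_le n (mat_lincomb n m A x) B}"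

definition sdp_feasible :: "nat \<Rightarrow> nat \<Rightarrow> (nat \<Rightarrow> real mat) \<Rightarrow> real mat \<Rightarrow> bool" where
  "sdp_feasible n m A B \<longleftrightarrow> sdp_feasible_set n m A B \<noteq> {}"

definition sdp_primal_value ::
  "nat \<Rightarrow> nat \<Rightarrow> (nat \<Rightarrow> real mat) \<Rightarrow> real mat \<Rightarrow> real vec \<Rightarrow> ereal" where
  "sdp_primal_value n m A B c = (SUP x\<in>sdp_feasible_set n m A B. ereal (\<Sum>i<m. c $ i * x $ i))"

definition sdp_dual_feasible_set ::
  "nat \<Rightarrow> nat \<Rightarrow> (nat \<Rightarrow> real mat) \<Rightarrow> real vec \<Rightarrow> real mat set" where
  "sdp_dual_feasible_set n m A c = {Y. psd_mat n Y \<and> (\<forall>i<m. mat_ip (A i) Y = c $ i)}"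

text \<open>Feasibility is not listed: for an infeasible system the supremum is \<open>-\<infinity>\<close>, hence not finite.\<close>

definition badly_behaved :: "nat \<Rightarrow> nat \<Rightarrow> (nat \<Rightarrow> real mat) \<Rightarrow> real mat \<Rightarrow> bool" where
  "badly_behaved n m A B \<longleftrightarrow>
     (\<exists>c\<in>carrier_vec m. \<bar>sdp_primal_value n m A B c\<bar> \<noteq> \<infinity> \<and>
        \<not> (\<exists>Y\<in>sdp_dual_feasible_set n m A c. ereal (mat_ip B Y) = sdp_primal_value n m A B c))"

definition is_slack :: "nat \<Rightarrow> nat \<Rightarrow> (nat \<Rightarrow> real mat) \<Rightarrow> real mat \<Rightarrow> real mat \<Rightarrow> bool" where
  "is_slack n m A B S \<longleftrightarrow> psd_mat n S \<and> (\<exists>x\<in>carrier_vec m. S = B - mat_lincomb n m A x)"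

definition is_max_rank_slack ::
  "nat \<Rightarrow> nat \<Rightarrow> (nat \<Rightarrow> real mat) \<Rightarrow> real mat \<Rightarrow> real mat \<Rightarrow> bool" where
  "is_max_rank_slack n m A B Z \<longleftrightarrow> is_slack n m A B Z \<and>
     (\<forall>S. is_slack n m A B S \<longrightarrow> vec_space.rank n S \<le> vec_space.rank n Z)"

text \<open>The index \<open>n\<close> is the number of rows of \<open>M\<close>.\<close>

abbreviation mat_range :: "nat \<Rightarrow> real mat \<Rightarrow> real vec set" where
  "mat_range n M \<equiv> vec_space.col_space n M"

end

theory Submission
  imports Defs
begin

text \<open>
  After shifting by a feasible point one may take \<open>B = Z\<close>. By maximality of the rank of \<open>Z\<close>, every
  slack vanishes outside the leading \<open>r \<times> r\<close> block.

  If \<open>V\<close> exists, then \<open>V\<^sub>1\<^sub>2 \<noteq> 0\<close>, and the objective \<open>c\<^sub>i = A\<^sub>i \<bullet> Y\<^sub>0\<close> with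
  \<open>Y\<^sub>0 = (0, - V\<^sub>1\<^sub>2; - V\<^sub>1\<^sub>2\<^sup>T, 0)\<close> is constant on the feasible set. A dual optimal \<open>Y\<close> has
  \<open>Y \<bullet> Z = 0\<close>, so only its block \<open>Y\<^sub>2\<^sub>2\<close> is nonzero, and \<open>0 \<le> Y\<^sub>2\<^sub>2 \<bullet> V\<^sub>2\<^sub>2 = Y \<bullet> V = Y\<^sub>0 \<bullet> V < 0\<close>.

  If no such \<open>V\<close> exists, then a linear combination with \<open>V\<^sub>2\<^sub>2 \<succeq> 0\<close> has
  \<open>R(V\<^sub>1\<^sub>2\<^sup>T) \<subseteq> R(V\<^sub>2\<^sub>2)\<close>, so that \<open>Z + \<epsilon> V\<close> is a slack for small \<open>\<epsilon> > 0\<close>; hence \<open>V\<^sub>1\<^sub>2 = 0\<close> and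
  \<open>V\<^sub>2\<^sub>2 = 0\<close>. Given \<open>c\<close> with finite value, the problem restricted to the leading block satisfies
  Slater's condition and has an optimal dual solution \<open>Y\<^sub>1\<^sub>1\<close>. The remaining functional
  \<open>c\<^sub>i - A\<^sub>i\<^sub>,\<^sub>1\<^sub>1 \<bullet> Y\<^sub>1\<^sub>1\<close> depends only on the trailing blocks of the linear combinations. No nonzero
  trailing block is psd, so by Gordan's alternative some positive definite \<open>P\<close> is orthogonal to all of
  them; adding a multiple of \<open>P\<close> to a representing matrix makes the functional \<open>\<bullet> Y\<^sub>2\<^sub>2\<close> with
  \<open>Y\<^sub>2\<^sub>2 \<succeq> 0\<close>, and \<open>diag(Y\<^sub>1\<^sub>1, Y\<^sub>2\<^sub>2)\<close> is dual optimal.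

  Both duality steps are separations in finitely many coordinates of a convex cone whose projection
  is a subspace, for which one coordinate can be treated at a time and no topology is needed.
\<close>

section \<open>A separation theorem for convex cones\<close>

text \<open>A Hahn-Banach extension carried out one coordinate at a time. \<open>C\<close> is a
  convex cone of pairs \<open>(s, z)\<close>; the fourth assumption makes its projection to
  \<open>z\<close> a subspace, which replaces any closedness or interior condition.\<close>

lemma cone_functional_exists:
  fixes C :: "real \<Rightarrow> ('a \<Rightarrow> real) \<Rightarrow> bool"
  assumes "finite I"
    and "\<And>s z s' z'. C s z \<Longrightarrow> C s' z' \<Longrightarrow> C (s + s') (\<lambda>i. z i + z' i)"
    and "\<And>a s z. 0 < a \<Longrightarrow> C s z \<Longrightarrow> C (a * s) (\<lambda>i. a * z i)"
    and "\<And>s z. C s z \<Longrightarrow> \<exists>s'. C s' (\<lambda>i. - z i)"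
    and "\<And>s z. C s z \<Longrightarrow> \<forall>i\<in>I. z i = 0 \<Longrightarrow> 0 \<le> s"
  shows "\<exists>y. \<forall>s z. C s z \<longrightarrow> 0 \<le> s + (\<Sum>i\<in>I. y i * z i)"
  using assms
proof (induction I arbitrary: C rule: finite_induct)
  case empty
  then show ?case by simp
next
  case (insert a I)
  note add = insert.prems(1) and scale = insert.prems(2) and neg = insert.prems(3)
    and nonneg = insert.prems(4)
  \<comment> \<open>A coefficient \<open>c\<close> for coordinate \<open>a\<close> must satisfy
    \<open>s + c >= 0\<close> where \<open>z a = 1\<close> and \<open>s - c >= 0\<close> where
    \<open>z a = - 1\<close>. So \<open>Lo\<close> collects its lower bounds and \<open>Up\<close>
    its upper bounds.\<close>
  define Lo where "Lo = {- s | s z. C s z \<and> (\<forall>i\<in>I. z i = 0) \<and> z a = 1}"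
  define Up where "Up = {s | s z. C s z \<and> (\<forall>i\<in>I. z i = 0) \<and> z a = - 1}"
  have le: "l \<le> u" if "l \<in> Lo" "u \<in> Up" for l u
  proof -
    obtain s z where 1: "l = - s" "C s z" "\<forall>i\<in>I. z i = 0" "z a = 1"
      using \<open>l \<in> Lo\<close> unfolding Lo_def by blast
    obtain z' where 2: "C u z'" "\<forall>i\<in>I. z' i = 0" "z' a = - 1"
      using \<open>u \<in> Up\<close> unfolding Up_def by blast
    have "0 \<le> s + u"
      by (rule nonneg[OF add[OF 1(2) 2(1)]]) (use 1 2 in auto)
    then show ?thesis using 1 by simp
  qed
  \<comment> \<open>Since the projection is closed under negation, bounds occur on both sides or on
    neither. Hence \<open>Sup Lo\<close> is a real number whenever there is any constraint at
    all.\<close>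
  have ne: "Lo \<noteq> {} \<longleftrightarrow> Up \<noteq> {}"
  proof
    assume "Lo \<noteq> {}"
    then obtain s z where 1: "C s z" "\<forall>i\<in>I. z i = 0" "z a = 1"
      unfolding Lo_def by blast
    obtain s' where "C s' (\<lambda>i. - z i)" using neg[OF 1(1)] by blast
    then have "s' \<in> Up" unfolding Up_def using 1 by force
    then show "Up \<noteq> {}" by blast
  next
    assume "Up \<noteq> {}"
    then obtain s z where 1: "C s z" "\<forall>i\<in>I. z i = 0" "z a = - 1"
      unfolding Up_def by blast
    obtain s' where "C s' (\<lambda>i. - z i)" using neg[OF 1(1)] by blast
    then have "- s' \<in> Lo" unfolding Lo_def using 1 by force
    then show "Lo \<noteq> {}" by blast
  qed
  have "\<exists>c. (\<forall>l\<in>Lo. l \<le> c) \<and> (\<forall>u\<in>Up. c \<le> u)"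
  proof (cases "Lo = {}")
    case True
    then show ?thesis using ne by auto
  next
    case False
    then obtain u where "u \<in> Up" using ne by blast
    then have "bdd_above Lo" using le by (meson bdd_aboveI)
    then have "\<forall>l\<in>Lo. l \<le> Sup Lo" by (simp add: cSup_upper)
    moreover have "\<forall>u\<in>Up. Sup Lo \<le> u" using False le by (meson cSup_least)
    ultimately show ?thesis by blast
  qed
  then obtain c where c: "\<And>l. l \<in> Lo \<Longrightarrow> l \<le> c" "\<And>u. u \<in> Up \<Longrightarrow> c \<le> u" by blast
  \<comment> \<open>The term \<open>c * z a\<close> is absorbed into \<open>s\<close>. Over points
    vanishing on \<open>I\<close>, rescaling to \<open>z a = 1\<close> or \<open>z a = - 1\<close>
    turns nonnegativity into the bounds on \<open>c\<close>.\<close>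
  define C' where "C' s z \<longleftrightarrow> (\<exists>s0. C s0 z \<and> s = s0 + c * z a)" for s z
  have "\<exists>y. \<forall>s z. C' s z \<longrightarrow> 0 \<le> s + (\<Sum>i\<in>I. y i * z i)"
  proof (rule insert.IH)
    fix s z s' z' assume "C' s z" "C' s' z'"
    then obtain s0 s1 where 0: "C s0 z" "s = s0 + c * z a" "C s1 z'" "s' = s1 + c * z' a"
      unfolding C'_def by blast
    have "s + s' = (s0 + s1) + c * (z a + z' a)" using 0 by (simp add: algebra_simps)
    then show "C' (s + s') (\<lambda>i. z i + z' i)"
      unfolding C'_def using add[OF 0(1,3)] by blast
  next
    fix b s z assume b: "0 < (b::real)" and "C' s z"
    then obtain s0 where 0: "C s0 z" "s = s0 + c * z a" unfolding C'_def by blast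
    have "b * s = b * s0 + c * (b * z a)" using 0 by (simp add: algebra_simps)
    then show "C' (b * s) (\<lambda>i. b * z i)" unfolding C'_def using scale[OF b 0(1)] by blast
  next
    fix s z assume "C' s z"
    then show "\<exists>s'. C' s' (\<lambda>i. - z i)" unfolding C'_def using neg by blast
  next
    fix s z assume "C' s z" and z: "\<forall>i\<in>I. z i = 0"
    then obtain s0 where 0: "C s0 z" "s = s0 + c * z a" unfolding C'_def by blast
    consider "z a = 0" | "z a > 0" | "z a < 0" by linarith
    then show "0 \<le> s"
    proof cases
      case 1
      then show ?thesis using nonneg[OF 0(1)] z 0 by auto
    next
      case 2
      have "- (1 / z a * s0) \<in> Lo"
        unfolding Lo_def using scale[of "1 / z a", OF _ 0(1)] 2 z by force
      then have "- (1 / z a * s0) \<le> c" using c by blast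
      then show ?thesis using 2 0 by (simp add: field_simps)
    next
      case 3
      have "- 1 / z a * s0 \<in> Up"
        unfolding Up_def using scale[of "- 1 / z a", OF _ 0(1)] 3 z
        by (force simp: divide_less_0_iff)
      then have "c \<le> - 1 / z a * s0" using c by blast
      then show ?thesis using 3 0 by (simp add: field_simps)
    qed
  qed
  then obtain y where y: "\<And>s z. C' s z \<Longrightarrow> 0 \<le> s + (\<Sum>i\<in>I. y i * z i)" by blast
  have "0 \<le> s + (\<Sum>i\<in>insert a I. (y(a := c)) i * z i)" if "C s z" for s z
  proof -
    have "C' (s + c * z a) z" unfolding C'_def using that by blast
    then have "0 \<le> s + c * z a + (\<Sum>i\<in>I. y i * z i)" by (rule y)
    moreover have "(\<Sum>i\<in>I. (y(a := c)) i * z i) = (\<Sum>i\<in>I. y i * z i)"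
      by (rule sum.cong) (use insert.hyps in auto)
    ultimately show ?thesis using insert.hyps by simp
  qed
  then show ?case by blast
qed

section \<open>Positive semidefinite matrices over finite index sets\<close>

text \<open>Matrices become functions on index pairs. A block is then a restriction to a subset of
  indices, and the cone theorem applies with the pairs as coordinates.\<close>

definition entry_ip :: "'a set \<Rightarrow> ('a \<times> 'a \<Rightarrow> real) \<Rightarrow> ('a \<times> 'a \<Rightarrow> real) \<Rightarrow> real" where
  "entry_ip S X Y = (\<Sum>p\<in>S \<times> S. X p * Y p)"

definition outer :: "('a \<Rightarrow> real) \<Rightarrow> ('a \<Rightarrow> real) \<Rightarrow> 'a \<times> 'a \<Rightarrow> real" where
  "outer v w = (\<lambda>(i, j). v i * w j)"

definition id_entries :: "'a \<times> 'a \<Rightarrow> real" where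
  "id_entries = (\<lambda>(i, j). if i = j then 1 else 0)"

definition symmetric_on :: "'a set \<Rightarrow> ('a \<times> 'a \<Rightarrow> real) \<Rightarrow> bool" where
  "symmetric_on S X \<longleftrightarrow> (\<forall>i\<in>S. \<forall>j\<in>S. X (i, j) = X (j, i))"

definition psd_on :: "'a set \<Rightarrow> ('a \<times> 'a \<Rightarrow> real) \<Rightarrow> bool" where
  "psd_on S X \<longleftrightarrow> symmetric_on S X \<and> (\<forall>v. 0 \<le> entry_ip S X (outer v v))"

text \<open>Separation yields functionals that need not be symmetric. Symmetrising them leaves their
  values on symmetric matrices unchanged.\<close>

definition sym_part :: "('a \<times> 'a \<Rightarrow> real) \<Rightarrow> 'a \<times> 'a \<Rightarrow> real" where
  "sym_part X = (\<lambda>(i, j). (X (i, j) + X (j, i)) / 2)"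

section \<open>Bilinearity and symmetry of the entrywise inner product\<close>

lemma entry_ip_cong:
  assumes "\<And>i j. i \<in> S \<Longrightarrow> j \<in> S \<Longrightarrow> X (i, j) = X' (i, j)"
    "\<And>i j. i \<in> S \<Longrightarrow> j \<in> S \<Longrightarrow> Y (i, j) = Y' (i, j)"
  shows "entry_ip S X Y = entry_ip S X' Y'"
  unfolding entry_ip_def by (rule sum.cong) (use assms in auto)

lemma entry_ip_commute: "entry_ip S X Y = entry_ip S Y X"
  by (simp add: entry_ip_def mult.commute)

lemma entry_ip_left [simp]:
  "entry_ip S (\<lambda>p. X p + X' p) Y = entry_ip S X Y + entry_ip S X' Y"
  "entry_ip S (\<lambda>p. X p - X' p) Y = entry_ip S X Y - entry_ip S X' Y"
  "entry_ip S (\<lambda>p. - X p) Y = - entry_ip S X Y"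
  "entry_ip S (\<lambda>p. a * X p) Y = a * entry_ip S X Y"
  "entry_ip S (\<lambda>p. X p / a) Y = entry_ip S X Y / a"
  "entry_ip S (\<lambda>p. 0) Y = 0"
  by (simp_all add: entry_ip_def algebra_simps sum.distrib sum_subtractf sum_negf sum_distrib_left
      sum_divide_distrib)

lemma entry_ip_right [simp]:
  "entry_ip S Y (\<lambda>p. X p + X' p) = entry_ip S Y X + entry_ip S Y X'"
  "entry_ip S Y (\<lambda>p. X p - X' p) = entry_ip S Y X - entry_ip S Y X'"
  "entry_ip S Y (\<lambda>p. - X p) = - entry_ip S Y X"
  "entry_ip S Y (\<lambda>p. a * X p) = a * entry_ip S Y X"
  "entry_ip S Y (\<lambda>p. X p / a) = entry_ip S Y X / a"
  "entry_ip S Y (\<lambda>p. 0) = 0"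
  by (simp_all only: entry_ip_commute[of S Y] entry_ip_left)

lemma entry_ip_sum_left:
  "entry_ip S (\<lambda>p. \<Sum>k\<in>K. x k * A k p) Y = (\<Sum>k\<in>K. x k * entry_ip S (A k) Y)"
  unfolding entry_ip_def sum_distrib_left sum_distrib_right
  by (subst sum.swap) (simp add: mult.assoc)

lemma entry_ip_id:
  assumes "finite S"
  shows "entry_ip S X id_entries = (\<Sum>i\<in>S. X (i, i))"
proof -
  have "entry_ip S X id_entries = (\<Sum>i\<in>S. \<Sum>j\<in>S. if i = j then X (i, j) else 0)"
    unfolding entry_ip_def sum.cartesian_product
    by (rule sum.cong) (auto simp: id_entries_def)
  also have "\<dots> = (\<Sum>i\<in>S. X (i, i))"
    using assms by (auto intro!: sum.cong simp: sum.delta')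
  finally show ?thesis .
qed

lemma entry_ip_outer:
  "entry_ip S X (outer v w) = (\<Sum>i\<in>S. v i * (\<Sum>j\<in>S. X (i, j) * w j))"
  unfolding entry_ip_def outer_def sum_distrib_left sum.cartesian_product
  by (rule sum.cong) auto

lemma entry_ip_swap: "entry_ip S X (\<lambda>(i, j). Y (j, i)) = entry_ip S (\<lambda>(i, j). X (j, i)) Y"
  unfolding entry_ip_def
  by (rule sum.reindex_bij_witness[where i = prod.swap and j = prod.swap]) auto

lemma entry_ip_sym_part:
  assumes "symmetric_on S X"
  shows "entry_ip S X (sym_part Y) = entry_ip S X Y"
proof -
  have "sym_part Y = (\<lambda>p. (Y p + (\<lambda>(i, j). Y (j, i)) p) / 2)"
    by (auto simp: sym_part_def)
  then have "entry_ip S X (sym_part Y) =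
      (entry_ip S X Y + entry_ip S X (\<lambda>(i, j). Y (j, i))) / 2"
    by (simp only: entry_ip_right)
  also have "entry_ip S X (\<lambda>(i, j). Y (j, i)) = entry_ip S X Y"
    unfolding entry_ip_swap by (rule entry_ip_cong) (use assms in \<open>auto simp: symmetric_on_def\<close>)
  finally show ?thesis by simp
qed

lemma symmetric_onD: "symmetric_on S X \<Longrightarrow> i \<in> S \<Longrightarrow> j \<in> S \<Longrightarrow> X (i, j) = X (j, i)"
  by (simp add: symmetric_on_def)

lemma symmetric_on_sym_part: "symmetric_on S (sym_part X)"
  by (simp add: symmetric_on_def sym_part_def add.commute)

lemma symmetric_on_lincomb:
  "symmetric_on S X \<Longrightarrow> symmetric_on S Y \<Longrightarrow> symmetric_on S (\<lambda>p. X p + Y p)"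
  "symmetric_on S X \<Longrightarrow> symmetric_on S Y \<Longrightarrow> symmetric_on S (\<lambda>p. X p - Y p)"
  "symmetric_on S X \<Longrightarrow> symmetric_on S (\<lambda>p. - X p)"
  "symmetric_on S X \<Longrightarrow> symmetric_on S (\<lambda>p. a * X p)"
  "symmetric_on S X \<Longrightarrow> symmetric_on S (\<lambda>p. X p / a)"
  "symmetric_on S (\<lambda>p. 0)"
  by (auto simp: symmetric_on_def)

lemma symmetric_on_sum:
  assumes "\<And>k. k \<in> K \<Longrightarrow> symmetric_on S (A k)"
  shows "symmetric_on S (\<lambda>p. \<Sum>k\<in>K. x k * A k p)"
  unfolding symmetric_on_def using assms by (auto simp: symmetric_on_def intro!: sum.cong)

lemma symmetric_on_id: "symmetric_on S id_entries"
  by (auto simp: symmetric_on_def id_entries_def)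

lemma symmetric_on_outer: "symmetric_on S (outer v v)"
  by (auto simp: symmetric_on_def outer_def)

section \<open>The cone of psd matrices\<close>

lemma psd_on_sym: "psd_on S X \<Longrightarrow> symmetric_on S X"
  by (simp add: psd_on_def)

lemma psd_on_quadratic: "psd_on S X \<Longrightarrow> 0 \<le> entry_ip S X (outer v v)"
  by (simp add: psd_on_def)

lemma psd_on_cong:
  assumes "\<And>i j. i \<in> S \<Longrightarrow> j \<in> S \<Longrightarrow> X (i, j) = Y (i, j)" "psd_on S X"
  shows "psd_on S Y"
proof -
  have "entry_ip S X (outer v v) = entry_ip S Y (outer v v)" for v
    by (rule entry_ip_cong) (use assms in auto)
  then show ?thesis using assms by (simp add: psd_on_def symmetric_on_def)
qed

lemma psd_on_add: "psd_on S X \<Longrightarrow> psd_on S Y \<Longrightarrow> psd_on S (\<lambda>p. X p + Y p)"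
  by (simp add: psd_on_def symmetric_on_lincomb)

lemma psd_on_scale: "0 \<le> a \<Longrightarrow> psd_on S X \<Longrightarrow> psd_on S (\<lambda>p. a * X p)"
  by (simp add: psd_on_def symmetric_on_lincomb)

lemma psd_on_zero: "psd_on S (\<lambda>p. 0)"
  by (simp add: psd_on_def symmetric_on_lincomb)

lemma psd_on_outer: "psd_on S (outer v v)"
proof -
  have "entry_ip S (outer v v) (outer w w) = (\<Sum>i\<in>S. v i * w i)\<^sup>2" for w
    unfolding entry_ip_outer power2_eq_square sum_distrib_right
    by (rule sum.cong) (auto simp: outer_def sum_distrib_left sum_distrib_right algebra_simps)
  then show ?thesis by (simp add: psd_on_def symmetric_on_outer)
qed

lemma psd_on_id:
  assumes "finite S"
  shows "psd_on S id_entries"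
  unfolding psd_on_def
  by (simp add: symmetric_on_id entry_ip_commute[of S id_entries] entry_ip_id[OF assms] outer_def sum_nonneg)

text \<open>One half of the self-duality of the psd cone: rank-one test matrices
  \<open>outer v v\<close> already recover the quadratic form.\<close>

lemma psd_on_sym_part:
  assumes "\<And>X. psd_on S X \<Longrightarrow> 0 \<le> entry_ip S X Y"
  shows "psd_on S (sym_part Y)"
  using assms[OF psd_on_outer]
  by (simp add: psd_on_def symmetric_on_sym_part entry_ip_commute[of S "sym_part Y"]
      entry_ip_sym_part symmetric_on_outer)

lemma psd_on_subset:
  assumes "finite T" "S \<subseteq> T" "psd_on T X"
  shows "psd_on S X"
proof -
  have "0 \<le> entry_ip S X (outer v v)" for v
  proof -
    let ?w = "\<lambda>i. if i \<in> S then v i else 0"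
    have "entry_ip S X (outer v v) = entry_ip T X (outer ?w ?w)"
      unfolding entry_ip_def
      by (rule sum.mono_neutral_cong_left) (use assms in \<open>auto simp: outer_def split: if_splits\<close>)
    then show ?thesis using assms by (simp add: psd_on_def)
  qed
  then show ?thesis using assms unfolding psd_on_def symmetric_on_def by blast
qed

text \<open>The identity is an interior point of the psd cone. This supplies the closure under
  negation that \<open>cone_functional_exists\<close> asks for.\<close>

lemma psd_on_add_id:
  assumes fin: "finite S" and sym: "symmetric_on S X"
  shows "\<exists>t>0. psd_on S (\<lambda>p. X p + t * id_entries p)"
proof -
  \<comment> \<open>The sum of absolute values bounds the quadratic form by \<open>(t - 1)\<close>
    times the squared norm, since each product \<open>v i * v j\<close> is at most that norm in
    absolute value. The summand 1 keeps \<open>t\<close> positive even if \<open>X\<close>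
    vanishes.\<close>
  define t where "t = 1 + (\<Sum>p\<in>S \<times> S. \<bar>X p\<bar>)"
  have "0 \<le> entry_ip S (\<lambda>p. X p + t * id_entries p) (outer v v)" for v
  proof -
    define q where "q = (\<Sum>i\<in>S. (v i)\<^sup>2)"
    have q: "(v i)\<^sup>2 \<le> q" if "i \<in> S" for i
      unfolding q_def using fin that by (intro member_le_sum) auto
    have bound: "\<bar>v i * v j\<bar> \<le> q" if "i \<in> S" "j \<in> S" for i j
    proof -
      have "0 \<le> (\<bar>v i\<bar> - \<bar>v j\<bar>)\<^sup>2" by simp
      then have "2 * \<bar>v i * v j\<bar> \<le> (v i)\<^sup>2 + (v j)\<^sup>2"
        by (simp add: power2_diff abs_mult)
      then show ?thesis using q[OF that(1)] q[OF that(2)] by linarith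
    qed
    have "\<bar>entry_ip S X (outer v v)\<bar> \<le> (\<Sum>p\<in>S \<times> S. \<bar>X p * outer v v p\<bar>)"
      unfolding entry_ip_def by (rule sum_abs)
    also have "\<dots> \<le> (\<Sum>p\<in>S \<times> S. \<bar>X p\<bar> * q)"
      by (rule sum_mono) (use bound in \<open>auto simp: outer_def abs_mult intro!: mult_left_mono\<close>)
    also have "\<dots> = (t - 1) * q" by (simp add: t_def sum_distrib_right)
    finally have "\<bar>entry_ip S X (outer v v)\<bar> \<le> (t - 1) * q" .
    moreover have "entry_ip S id_entries (outer v v) = q"
      by (simp add: entry_ip_commute[of S id_entries] entry_ip_id[OF fin] outer_def q_def
          power2_eq_square)
    moreover have "0 \<le> q" by (simp add: q_def sum_nonneg)
    ultimately show ?thesis by (simp add: algebra_simps abs_le_iff)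
  qed
  moreover have "t > 0" by (simp add: t_def add_pos_nonneg sum_nonneg)
  ultimately show ?thesis
    using sym by (auto simp: psd_on_def symmetric_on_lincomb symmetric_on_id)
qed

text \<open>The quadratic form along coordinate \<open>a\<close> is a quadratic polynomial in
  \<open>b\<close>. Suitable choices of \<open>b\<close> give the sign of the diagonal, the Schur
  complement and the vanishing of rows.\<close>

lemma entry_ip_outer_shift:
  fixes v :: "'a \<Rightarrow> real" and a :: 'a and b :: real
  defines "w \<equiv> \<lambda>i. v i + (if i = a then b else 0)"
  assumes fin: "finite S" and sym: "symmetric_on S Y" and a: "a \<in> S"
  shows "entry_ip S Y (outer w w) =
    entry_ip S Y (outer v v) + 2 * b * (\<Sum>i\<in>S. Y (a, i) * v i) + b\<^sup>2 * Y (a, a)"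
proof -
  let ?e = "\<lambda>i. if i = a then b else 0"
  have 1: "outer w w = (\<lambda>p. outer v v p + outer v ?e p + outer ?e v p + outer ?e ?e p)"
    by (auto simp: outer_def w_def algebra_simps)
  have e: "(\<Sum>i\<in>S. f i * ?e i) = f a * b" for f
  proof -
    have "(\<Sum>i\<in>S. f i * ?e i) = (\<Sum>i\<in>S. if i = a then f i * b else 0)"
      by (rule sum.cong) auto
    then show ?thesis using fin a by simp
  qed
  have e': "(\<Sum>i\<in>S. ?e i * f i) = b * f a" for f
    using e[of f] by (simp add: mult.commute)
  have "(\<Sum>i\<in>S. v i * (Y (i, a) * b)) = b * (\<Sum>i\<in>S. Y (a, i) * v i)"
    unfolding sum_distrib_left by (rule sum.cong) (use sym a in \<open>auto simp: symmetric_on_def\<close>)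
  then show ?thesis
    unfolding 1 by (simp add: entry_ip_outer e e' power2_eq_square)
qed

section \<open>Diagonal entries, Schur complements and self-duality\<close>

lemma psd_on_diag_nonneg:
  assumes "finite S" "psd_on S Y" "a \<in> S"
  shows "0 \<le> Y (a, a)"
proof -
  show ?thesis
    using psd_on_quadratic[OF assms(2), of "\<lambda>i. 0 + (if i = a then 1 else 0)"]
    unfolding entry_ip_outer_shift[OF assms(1) psd_on_sym[OF assms(2)] assms(3)]
    by (simp add: entry_ip_outer)
qed

lemma psd_on_schur_complement:
  assumes fin: "finite S" and psd: "psd_on S Y" and a: "a \<in> S" and pos: "0 < Y (a, a)"
  shows "psd_on S (\<lambda>p. Y p - outer (\<lambda>i. Y (a, i)) (\<lambda>i. Y (a, i)) p / Y (a, a))"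
proof -
  let ?o = "outer (\<lambda>i. Y (a, i)) (\<lambda>i. Y (a, i))"
  have "0 \<le> entry_ip S Y (outer v v) - entry_ip S ?o (outer v v) / Y (a, a)" for v
  proof -
    define s where "s = (\<Sum>i\<in>S. Y (a, i) * v i)"
    have "entry_ip S ?o (outer v v) = s\<^sup>2"
      unfolding entry_ip_outer power2_eq_square sum_distrib_right s_def
      by (rule sum.cong) (auto simp: outer_def sum_distrib_left sum_distrib_right algebra_simps)
    \<comment> \<open>The shift \<open>b = - s / Y (a, a)\<close> minimises the quadratic in
      \<open>b\<close>; its minimum is the quadratic form of the Schur complement.\<close>
    moreover have "0 \<le> entry_ip S Y (outer v v) + 2 * (- s / Y (a, a)) * s + (- s / Y (a, a))\<^sup>2 * Y (a, a)"
      unfolding s_def entry_ip_outer_shift[OF fin psd_on_sym[OF psd] a, symmetric]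
      by (rule psd_on_quadratic[OF psd])
    ultimately show ?thesis using pos by (simp add: field_simps power2_eq_square)
  qed
  then show ?thesis
    unfolding psd_on_def using psd_on_sym[OF psd] by (simp add: symmetric_on_lincomb symmetric_on_outer)
qed

lemma psd_on_zero_diag:
  assumes fin: "finite S" and psd: "psd_on S Y" and a: "a \<in> S" "Y (a, a) = 0" and j: "j \<in> S"
  shows "Y (a, j) = 0"
proof (rule ccontr)
  assume nz: "Y (a, j) \<noteq> 0"
  let ?v = "\<lambda>i. if i = j then 1 else (0::real)"
  define q where "q = entry_ip S Y (outer ?v ?v)"
  have s: "(\<Sum>i\<in>S. Y (a, i) * ?v i) = Y (a, j)"
  proof -
    have "(\<Sum>i\<in>S. Y (a, i) * ?v i) = (\<Sum>i\<in>S. if i = j then Y (a, i) else 0)"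
      by (rule sum.cong) auto
    then show ?thesis using fin j by simp
  qed
  have "0 \<le> q + 2 * b * Y (a, j)" for b
    using entry_ip_outer_shift[OF fin psd_on_sym[OF psd] a(1), of ?v b] a(2)
      psd_on_quadratic[OF psd, of "\<lambda>i. ?v i + (if i = a then b else 0)"]
    unfolding q_def s by (simp only: mult_zero_right add_0_right)
  \<comment> \<open>With a zero diagonal entry the polynomial is affine in \<open>b\<close>. This
    \<open>b\<close> gives it the value - 1.\<close>
  from this[of "- (q + 1) / (2 * Y (a, j))"] show False using nz by (simp add: field_simps)
qed

text \<open>The other half of self-duality, without a spectral decomposition. Induction removes one
  index: \<open>Y\<close> is a psd rank-one matrix plus a Schur complement whose row and column
  \<open>a\<close> vanish.\<close>

lemma entry_ip_psd_nonneg: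
  assumes "finite S" "psd_on S X" "psd_on S Y"
  shows "0 \<le> entry_ip S X Y"
  using assms
proof (induction S arbitrary: X Y rule: finite_induct)
  case empty
  then show ?case by (simp add: entry_ip_def)
next
  case (insert a S)
  let ?T = "insert a S"
  have fin: "finite ?T" using insert by simp
  \<comment> \<open>A zero diagonal entry clears row and column \<open>a\<close>, so only the block
    on \<open>S\<close> contributes and the induction hypothesis applies.\<close>
  have zero_case: "0 \<le> entry_ip ?T X Y'" if psd: "psd_on ?T Y'" and zero: "Y' (a, a) = 0" for Y'
  proof -
    have row: "Y' (a, j) = 0" if "j \<in> ?T" for j
      by (rule psd_on_zero_diag[OF fin psd _ zero that]) simp
    moreover have "Y' (j, a) = 0" if "j \<in> ?T" for j
      using row[OF that] symmetric_onD[OF psd_on_sym[OF psd] that, of a] by simp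
    ultimately have "entry_ip ?T X Y' = entry_ip S X Y'"
      unfolding entry_ip_def by (intro sum.mono_neutral_right) (use fin in auto)
    then show ?thesis
      using insert.IH psd_on_subset[OF fin _ psd] psd_on_subset[OF fin _ insert.prems(1)] by auto
  qed
  show ?case
  proof (cases "Y (a, a) = 0")
    case True
    then show ?thesis using zero_case insert.prems by blast
  next
    case False
    then have pos: "0 < Y (a, a)"
      using psd_on_diag_nonneg[OF fin insert.prems(2), of a] by simp
    let ?o = "outer (\<lambda>i. Y (a, i)) (\<lambda>i. Y (a, i))"
    have "0 \<le> entry_ip ?T X (\<lambda>p. Y p - ?o p / Y (a, a))"
      by (rule zero_case[OF psd_on_schur_complement[OF fin insert.prems(2) _ pos]])
        (use pos in \<open>auto simp: outer_def\<close>)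
    then have "entry_ip ?T X ?o / Y (a, a) \<le> entry_ip ?T X Y" by simp
    moreover have "0 \<le> entry_ip ?T X ?o / Y (a, a)"
      using insert.prems(1) pos by (simp add: psd_on_def)
    ultimately show ?thesis by linarith
  qed
qed

section \<open>Duality for semidefinite systems\<close>

text \<open>The equations are first solved without a sign condition, which needs only that
  \<open>g\<close> vanishes on trivial combinations. A positive definite matrix orthogonal to all
  \<open>A k\<close> then repairs semidefiniteness without disturbing them.\<close>

lemma psd_dual_solution_if_no_psd_lincomb:
  fixes A :: "nat \<Rightarrow> 'a \<times> 'a \<Rightarrow> real"
  assumes fin: "finite S" and symA: "\<And>k. k < m \<Longrightarrow> symmetric_on S (A k)"
    and no_psd: "\<And>x. psd_on S (\<lambda>p. \<Sum>k<m. x k * A k p) \<Longrightarrow> \<forall>p\<in>S \<times> S. (\<Sum>k<m. x k * A k p) = 0"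
    and g: "\<And>x. \<forall>p\<in>S \<times> S. (\<Sum>k<m. x k * A k p) = 0 \<Longrightarrow> (\<Sum>k<m. g k * x k) = 0"
  shows "\<exists>Y. psd_on S Y \<and> (\<forall>k<m. entry_ip S (A k) Y = g k)"
proof -
  \<comment> \<open>Gordan's alternative: \<open>P + I\<close> is positive definite and orthogonal to every \<open>A k\<close>.\<close>
  have "\<exists>P. psd_on S P \<and> (\<forall>k<m. entry_ip S (A k) P = - entry_ip S (A k) id_entries)"
  proof (rule ccontr)
    assume no_P: "\<not> ?thesis"
    \<comment> \<open>The pairs for which \<open>z\<close>, shifted by \<open>t\<close> times the
      image of the identity, lies in the image of the psd cone. A pair with \<open>z = 0\<close> and
      \<open>t < 0\<close> would rescale to \<open>t = - 1\<close> and produce the missing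
      \<open>P\<close>.\<close>
    define C where "C t z \<longleftrightarrow> (\<exists>Y. psd_on S Y \<and>
      (\<forall>k<m. z k + t * entry_ip S (A k) id_entries = entry_ip S (A k) Y))" for t z
    have "\<exists>x. \<forall>t z. C t z \<longrightarrow> 0 \<le> t + (\<Sum>k<m. x k * z k)"
    proof (rule cone_functional_exists)
      fix t z t' z' assume "C t z" "C t' z'"
      then obtain Y Y' where Y:
        "psd_on S Y" "\<And>k. k < m \<Longrightarrow> z k + t * entry_ip S (A k) id_entries = entry_ip S (A k) Y"
        "psd_on S Y'" "\<And>k. k < m \<Longrightarrow> z' k + t' * entry_ip S (A k) id_entries = entry_ip S (A k) Y'"
        unfolding C_def by blast
      have "z k + z' k + (t + t') * entry_ip S (A k) id_entries = entry_ip S (A k) (\<lambda>p. Y p + Y' p)"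
        if "k < m" for k
        unfolding entry_ip_right Y(2,4)[OF that, symmetric] by (simp add: algebra_simps)
      then show "C (t + t') (\<lambda>k. z k + z' k)"
        unfolding C_def using psd_on_add[OF Y(1,3)] by blast
    next
      fix a t z assume a: "0 < (a::real)" and "C t z"
      then obtain Y where
        Y: "psd_on S Y" "\<And>k. k < m \<Longrightarrow> z k + t * entry_ip S (A k) id_entries = entry_ip S (A k) Y"
        unfolding C_def by blast
      have "a * z k + a * t * entry_ip S (A k) id_entries = entry_ip S (A k) (\<lambda>p. a * Y p)"
        if "k < m" for k
        unfolding entry_ip_right Y(2)[OF that, symmetric] by (simp add: algebra_simps)
      then show "C (a * t) (\<lambda>k. a * z k)"
        unfolding C_def using psd_on_scale[OF less_imp_le[OF a] Y(1)] by blast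
    next
      fix t z assume "C t z"
      then obtain Y where
        Y: "psd_on S Y" "\<And>k. k < m \<Longrightarrow> z k + t * entry_ip S (A k) id_entries = entry_ip S (A k) Y"
        unfolding C_def by blast
      \<comment> \<open>Adding a large multiple of the identity makes \<open>- Y\<close> psd, at the
        cost of changing only the coordinate \<open>t\<close>.\<close>
      obtain t0 where t0: "psd_on S (\<lambda>p. - Y p + t0 * id_entries p)"
        using psd_on_add_id[OF fin, of "\<lambda>p. - Y p"] psd_on_sym[OF Y(1)] symmetric_on_lincomb by blast
      have "- z k + (t0 - t) * entry_ip S (A k) id_entries =
          entry_ip S (A k) (\<lambda>p. - Y p + t0 * id_entries p)" if "k < m" for k
        using Y(2)[OF that] by (simp add: algebra_simps)
      then show "\<exists>t'. C t' (\<lambda>k. - z k)"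
        unfolding C_def using t0 by blast
    next
      fix t z assume "C t z" and z: "\<forall>k\<in>{..<m}. z k = 0"
      then obtain Y where
        Y: "psd_on S Y" "\<And>k. k < m \<Longrightarrow> t * entry_ip S (A k) id_entries = entry_ip S (A k) Y"
        unfolding C_def by auto
      show "0 \<le> t"
      proof (rule ccontr)
        assume t: "\<not> 0 \<le> t"
        have "entry_ip S (A k) (\<lambda>p. (- 1 / t) * Y p) = - entry_ip S (A k) id_entries" if "k < m" for k
          unfolding entry_ip_right Y(2)[OF that, symmetric] using t by simp
        moreover have "psd_on S (\<lambda>p. (- 1 / t) * Y p)"
          by (rule psd_on_scale[OF _ Y(1)]) (use t in \<open>simp add: field_simps\<close>)
        ultimately show False using no_P by blast
      qed
    qed simp
    then obtain x where x: "\<And>t z. C t z \<Longrightarrow> 0 \<le> t + (\<Sum>k<m. x k * z k)" by blast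
    have "psd_on S (\<lambda>p. \<Sum>k<m. x k * A k p)"
      unfolding psd_on_def
    proof (intro conjI allI)
      show "symmetric_on S (\<lambda>p. \<Sum>k<m. x k * A k p)"
        by (rule symmetric_on_sum) (use symA in auto)
      fix v
      \<comment> \<open>Rank-one matrices taken at \<open>t = 0\<close> show that the separating
        combination is psd, hence zero by \<open>no_psd\<close>.\<close>
      have "C 0 (\<lambda>k. entry_ip S (A k) (outer v v))"
        unfolding C_def using psd_on_outer by auto
      from x[OF this] show "0 \<le> entry_ip S (\<lambda>p. \<Sum>k<m. x k * A k p) (outer v v)"
        by (simp add: entry_ip_sum_left)
    qed
    then have "\<forall>p\<in>S \<times> S. (\<Sum>k<m. x k * A k p) = 0" by (rule no_psd)
    then have "entry_ip S (\<lambda>p. \<Sum>k<m. x k * A k p) id_entries = 0"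
      unfolding entry_ip_def by (intro sum.neutral ballI) (metis mult_zero_left)
    \<comment> \<open>The choice \<open>Y = 0\<close> puts this pair in \<open>C\<close>. The
      combination pairs to zero with the identity, so the separating inequality would read
      \<open>0 <= - 1\<close>.\<close>
    moreover have "C (- 1) (\<lambda>k. entry_ip S (A k) id_entries)"
      unfolding C_def using psd_on_zero by (intro exI[of _ "\<lambda>p. 0"]) auto
    ultimately show False using x[of "- 1"] by (force simp: entry_ip_sum_left)
  qed
  then obtain P where P: "psd_on S P"
    "\<And>k. k < m \<Longrightarrow> entry_ip S (A k) P = - entry_ip S (A k) id_entries" by blast
  \<comment> \<open>This cone is a subspace, so separation amounts to solving the linear equations.
    Unit vectors of both signs turn the inequality \<open>y'\<close> into equality.\<close>
  define C where "C s z \<longleftrightarrow> (\<exists>x. s = (\<Sum>k<m. g k * x k) \<and> z = (\<lambda>p. - (\<Sum>k<m. x k * A k p)))"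
    for s z
  have "\<exists>y. \<forall>s z. C s z \<longrightarrow> 0 \<le> s + (\<Sum>p\<in>S \<times> S. y p * z p)"
  proof (rule cone_functional_exists)
    show "finite (S \<times> S)" using fin by simp
  next
    fix s z s' z' assume "C s z" "C s' z'"
    then obtain x x' where "s = (\<Sum>k<m. g k * x k)" "z = (\<lambda>p. - (\<Sum>k<m. x k * A k p))"
      "s' = (\<Sum>k<m. g k * x' k)" "z' = (\<lambda>p. - (\<Sum>k<m. x' k * A k p))"
      unfolding C_def by blast
    then show "C (s + s') (\<lambda>p. z p + z' p)"
      unfolding C_def by (intro exI[of _ "\<lambda>k. x k + x' k"]) (auto simp: algebra_simps sum.distrib)
  next
    fix a s z assume "0 < (a::real)" "C s z"
    then obtain x where "s = (\<Sum>k<m. g k * x k)" "z = (\<lambda>p. - (\<Sum>k<m. x k * A k p))"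
      unfolding C_def by blast
    then show "C (a * s) (\<lambda>p. a * z p)"
      unfolding C_def
      by (intro exI[of _ "\<lambda>k. a * x k"]) (auto simp: algebra_simps sum_distrib_left)
  next
    fix s z assume "C s z"
    then obtain x where "z = (\<lambda>p. - (\<Sum>k<m. x k * A k p))"
      unfolding C_def by blast
    then have "C (\<Sum>k<m. g k * - x k) (\<lambda>p. - z p)"
      unfolding C_def by (intro exI[of _ "\<lambda>k. - x k"]) (auto simp: sum_negf)
    then show "\<exists>s'. C s' (\<lambda>p. - z p)" by blast
  next
    fix s z assume "C s z" "\<forall>p\<in>S \<times> S. z p = 0"
    then show "0 \<le> s" unfolding C_def using g by fastforce
  qed
  then obtain y where y: "\<And>s z. C s z \<Longrightarrow> 0 \<le> s + (\<Sum>p\<in>S \<times> S. y p * z p)" by blast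
  have y': "(\<Sum>k<m. x k * entry_ip S (A k) y) \<le> (\<Sum>k<m. g k * x k)" for x
  proof -
    have "(\<Sum>p\<in>S \<times> S. y p * - (\<Sum>k<m. x k * A k p)) = - entry_ip S y (\<lambda>p. \<Sum>k<m. x k * A k p)"
      by (simp add: entry_ip_def sum_negf)
    also have "\<dots> = - (\<Sum>k<m. x k * entry_ip S (A k) y)"
      unfolding entry_ip_commute[of S y] entry_ip_sum_left ..
    finally show ?thesis using y[of "\<Sum>k<m. g k * x k" "\<lambda>p. - (\<Sum>k<m. x k * A k p)"]
      unfolding C_def by auto
  qed
  have unit: "(\<Sum>k<m. f k * (if k = l then b else 0)) = f l * b"
    "(\<Sum>k<m. (if k = l then b else 0) * f k) = b * f l" if "l < m" for l b and f :: "nat \<Rightarrow> real"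
    using that by (simp_all add: if_distrib if_distribR sum.delta cong: if_cong)
  have y_eq: "entry_ip S (A l) y = g l" if "l < m" for l
    using y'[of "\<lambda>k. if k = l then 1 else 0"] y'[of "\<lambda>k. if k = l then - 1 else 0"]
    unfolding unit[OF that] by simp
  \<comment> \<open>Symmetrising and adding \<open>t\<close> times the identity makes the solution
    psd. Adding \<open>t * P\<close> as well restores its products with the
    \<open>A k\<close>.\<close>
  obtain t where t: "0 < t" "psd_on S (\<lambda>p. sym_part y p + t * id_entries p)"
    using psd_on_add_id[OF fin symmetric_on_sym_part] by blast
  have "psd_on S (\<lambda>p. (sym_part y p + t * id_entries p) + t * P p)"
    by (rule psd_on_add[OF t(2) psd_on_scale[OF less_imp_le[OF t(1)] P(1)]])
  moreover have "entry_ip S (A k) (\<lambda>p. (sym_part y p + t * id_entries p) + t * P p) = g k"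
    if "k < m" for k
    using that y_eq P(2) entry_ip_sym_part[OF symA] by simp
  ultimately show ?thesis by blast
qed

text \<open>The subspace \<open>D\<close> of admissible coefficient vectors plays the role of the face constraint.\<close>

lemma psd_dual_solution_slater:
  fixes A :: "nat \<Rightarrow> 'a \<times> 'a \<Rightarrow> real"
  assumes fin: "finite R" and symA: "\<And>k. k < m \<Longrightarrow> symmetric_on R (A k)"
    and D_add: "\<And>x x'. x \<in> D \<Longrightarrow> x' \<in> D \<Longrightarrow> (\<lambda>k. x k + x' k) \<in> D"
    and D_scale: "\<And>a x. x \<in> D \<Longrightarrow> (\<lambda>k. a * x k) \<in> D"
    and D_ne: "D \<noteq> {}"
    and bound: "\<And>t x. x \<in> D \<Longrightarrow> psd_on R (\<lambda>p. t * id_entries p - (\<Sum>k<m. x k * A k p)) \<Longrightarrow>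
      (\<Sum>k<m. c k * x k) \<le> t * val"
  shows "\<exists>Y. psd_on R Y \<and> entry_ip R id_entries Y = val \<and>
    (\<forall>x\<in>D. (\<Sum>k<m. x k * entry_ip R (A k) Y) = (\<Sum>k<m. c k * x k))"
proof -
  have D0: "(\<lambda>k. 0) \<in> D" using D_ne D_scale[of _ 0] by fastforce
  define W where "W x p = (\<Sum>k<m. x k * A k p)" for x p
  have W_add: "W (\<lambda>k. x k + x' k) p = W x p + W x' p" for x x' p
    by (simp add: W_def algebra_simps sum.distrib)
  have W_scale: "W (\<lambda>k. a * x k) p = a * W x p" for a x p
    by (simp add: W_def algebra_simps sum_distrib_left)
  have W_0: "W (\<lambda>k. 0) p = 0" for p by (simp add: W_def)
  have symW: "symmetric_on R (W x)" for x
    using symmetric_on_sum[of "{..<m}" R A x] symA unfolding W_def by auto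
  \<comment> \<open>The homogenised problem: \<open>t\<close> scales the identity and may have
    either sign, while \<open>z\<close> perturbs the constraint. Nonnegativity of \<open>s\<close>
    over \<open>z = 0\<close> is the assumption \<open>bound\<close>.\<close>
  define C where "C s z \<longleftrightarrow> (\<exists>t x. x \<in> D \<and> s = t * val - (\<Sum>k<m. c k * x k) \<and>
    psd_on R (\<lambda>p. z p + (t * id_entries p - W x p)))" for s z
  have "\<exists>y. \<forall>s z. C s z \<longrightarrow> 0 \<le> s + (\<Sum>p\<in>R \<times> R. y p * z p)"
  proof (rule cone_functional_exists)
    show "finite (R \<times> R)" using fin by simp
  next
    fix s z s' z' assume "C s z" "C s' z'"
    then obtain t x t' x' where 1: "x \<in> D" "s = t * val - (\<Sum>k<m. c k * x k)"
      "psd_on R (\<lambda>p. z p + (t * id_entries p - W x p))"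
      "x' \<in> D" "s' = t' * val - (\<Sum>k<m. c k * x' k)"
      "psd_on R (\<lambda>p. z' p + (t' * id_entries p - W x' p))"
      unfolding C_def by blast
    have "psd_on R (\<lambda>p. (z p + z' p) + ((t + t') * id_entries p - W (\<lambda>k. x k + x' k) p))"
      by (rule psd_on_cong[OF _ psd_on_add[OF 1(3,6)]]) (simp add: W_add algebra_simps)
    moreover have "s + s' = (t + t') * val - (\<Sum>k<m. c k * (x k + x' k))"
      using 1 by (simp add: algebra_simps sum.distrib)
    ultimately show "C (s + s') (\<lambda>p. z p + z' p)"
      unfolding C_def using D_add[OF 1(1,4)] by blast
  next
    fix a s z assume a: "0 < (a::real)" and "C s z"
    then obtain t x where 1: "x \<in> D" "s = t * val - (\<Sum>k<m. c k * x k)"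
      "psd_on R (\<lambda>p. z p + (t * id_entries p - W x p))"
      unfolding C_def by blast
    have "psd_on R (\<lambda>p. a * z p + ((a * t) * id_entries p - W (\<lambda>k. a * x k) p))"
      by (rule psd_on_cong[OF _ psd_on_scale[OF less_imp_le[OF a] 1(3)]])
        (simp add: W_scale algebra_simps)
    moreover have "a * s = (a * t) * val - (\<Sum>k<m. c k * (a * x k))"
      unfolding 1(2) by (simp add: right_diff_distrib sum_distrib_left mult.left_commute mult.assoc)
    ultimately show "C (a * s) (\<lambda>p. a * z p)"
      unfolding C_def using D_scale[OF 1(1)] by blast
  next
    fix s z assume "C s z"
    then obtain t x where 1: "x \<in> D" "psd_on R (\<lambda>p. z p + (t * id_entries p - W x p))"
      unfolding C_def by blast
    \<comment> \<open>Slater's condition enters here: the right-hand side is the identity, which is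
      interior, so a change of \<open>t\<close> accommodates any perturbation.\<close>
    obtain t0 where "psd_on R (\<lambda>p. - (z p + (t * id_entries p - W x p)) + t0 * id_entries p)"
      using psd_on_add_id[OF fin symmetric_on_lincomb(3)[OF psd_on_sym[OF 1(2)]]] by blast
    then have "psd_on R (\<lambda>p. - z p + ((t0 - t) * id_entries p - W (\<lambda>k. - 1 * x k) p))"
      by (rule psd_on_cong[rotated]) (simp only: W_scale, simp add: algebra_simps)
    then show "\<exists>s'. C s' (\<lambda>p. - z p)"
      unfolding C_def using D_scale[OF 1(1)] by blast
  next
    fix s z assume "C s z" and z: "\<forall>p\<in>R \<times> R. z p = 0"
    then obtain t x where 1: "x \<in> D" "s = t * val - (\<Sum>k<m. c k * x k)"
      "psd_on R (\<lambda>p. z p + (t * id_entries p - W x p))"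
      unfolding C_def by blast
    have "psd_on R (\<lambda>p. t * id_entries p - W x p)"
      by (rule psd_on_cong[OF _ 1(3)]) (use z in auto)
    then show "0 \<le> s" using bound[OF 1(1)] 1(2) unfolding W_def by simp
  qed
  then obtain y where y: "\<And>s z. C s z \<Longrightarrow> 0 \<le> s + entry_ip R y z"
    unfolding entry_ip_def by blast
  have "psd_on R (sym_part y)"
  proof (rule psd_on_sym_part)
    fix X assume X: "psd_on R X"
    \<comment> \<open>With \<open>t = 0\<close> and \<open>x = 0\<close> every psd perturbation is
      allowed, which forces the functional to be nonnegative on the psd cone.\<close>
    have "C 0 X"
      unfolding C_def by (rule exI[of _ 0], rule exI[of _ "\<lambda>k. 0"]) (use X D0 in \<open>simp add: W_0\<close>)
    from y[OF this] show "0 \<le> entry_ip R X y" by (simp add: entry_ip_commute)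
  qed
  moreover
  have ineq: "0 \<le> t * val - (\<Sum>k<m. c k * x k) - t * entry_ip R id_entries (sym_part y)
      + (\<Sum>k<m. x k * entry_ip R (A k) (sym_part y))" if x: "x \<in> D" for t x
  proof -
    \<comment> \<open>This perturbation makes the slack exactly zero, so \<open>t\<close> and
      \<open>x\<close> are free. Taking both signs of each yields the two equalities.\<close>
    have "C (t * val - (\<Sum>k<m. c k * x k)) (\<lambda>p. W x p - t * id_entries p)"
      unfolding C_def using x psd_on_zero by (intro exI[of _ t] exI[of _ x]) simp
    from y[OF this] have "0 \<le> t * val - (\<Sum>k<m. c k * x k) - t * entry_ip R id_entries y + entry_ip R (W x) y"
      by (simp add: entry_ip_commute[of R y])
    moreover have "entry_ip R id_entries y = entry_ip R id_entries (sym_part y)"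
      by (rule entry_ip_sym_part[OF symmetric_on_id, symmetric])
    moreover have "entry_ip R (W x) y = entry_ip R (W x) (sym_part y)"
      by (rule entry_ip_sym_part[OF symW, symmetric])
    moreover have "entry_ip R (W x) (sym_part y) = (\<Sum>k<m. x k * entry_ip R (A k) (sym_part y))"
      unfolding W_def entry_ip_sum_left ..
    ultimately show ?thesis by simp
  qed
  have "entry_ip R id_entries (sym_part y) = val"
    using ineq[OF D0, of 1] ineq[OF D0, of "- 1"] by simp
  moreover have "(\<Sum>k<m. x k * entry_ip R (A k) (sym_part y)) = (\<Sum>k<m. c k * x k)"
    if x: "x \<in> D" for x
    using ineq[OF x, of 0] ineq[OF D_scale[OF x, of "- 1"], of 0] by (simp add: sum_negf)
  ultimately show ?thesis by blast
qed

text \<open>The hypothesis on \<open>K\<close> is the range condition: the off-diagonal block is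
  \<open>K\<close> times the trailing block. A block congruence then separates \<open>R\<close> from
  \<open>Q\<close>, and on \<open>R\<close> the identity dominates a small multiple of the remaining
  Schur complement.\<close>

lemma psd_on_block_perturbation:
  assumes fin: "finite R" "finite Q" and disj: "R \<inter> Q = {}"
    and sym: "symmetric_on (R \<union> Q) W" and psd: "psd_on Q W"
    and K: "\<And>i j. i \<in> R \<Longrightarrow> j \<in> Q \<Longrightarrow> W (i, j) = (\<Sum>l\<in>Q. K i l * W (l, j))"
  shows "\<exists>e>0. psd_on (R \<union> Q) (\<lambda>p. (if p \<in> R \<times> R then id_entries p else 0) + e * W p)"
proof -
  \<comment> \<open>\<open>G\<close> is \<open>K\<close> times the trailing block times the
    transpose of \<open>K\<close>, the part of the leading block that the trailing block accounts
    for.\<close>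
  define G where "G = (\<lambda>(i, i'). \<Sum>l\<in>Q. K i l * W (l, i'))"
  have WQR: "W (l, i) = (\<Sum>l'\<in>Q. K i l' * W (l', l))" if "l \<in> Q" "i \<in> R" for l i
    using symmetric_onD[OF sym, of l i] K[OF that(2,1)] that by simp
  have symQ: "W (l, l') = W (l', l)" if "l \<in> Q" "l' \<in> Q" for l l'
    using symmetric_onD[OF sym, of l l'] that by simp
  have symG: "symmetric_on R G"
    unfolding symmetric_on_def
  proof (intro ballI)
    fix i j assume ij: "i \<in> R" "j \<in> R"
    have "G (i, j) = (\<Sum>l\<in>Q. \<Sum>l'\<in>Q. K i l * (K j l' * W (l', l)))"
      by (simp add: G_def WQR ij sum_distrib_left)
    also have "\<dots> = (\<Sum>l\<in>Q. \<Sum>l'\<in>Q. K j l * (K i l' * W (l', l)))"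
      by (subst sum.swap) (auto intro!: sum.cong simp: symQ)
    also have "\<dots> = G (j, i)" by (simp add: G_def WQR ij sum_distrib_left)
    finally show "G (i, j) = G (j, i)" .
  qed
  have symR: "symmetric_on R W" using sym by (auto simp: symmetric_on_def)
  obtain t where t: "0 < t" "psd_on R (\<lambda>p. (W p - G p) + t * id_entries p)"
    using psd_on_add_id[OF fin(1) symmetric_on_lincomb(2)[OF symR symG]] by blast
  \<comment> \<open>Completing the square: the \<open>Q\<close>-part of \<open>v\<close> is shifted
    by the transpose of \<open>K\<close> applied to its \<open>R\<close>-part.\<close>
  have quad: "entry_ip (R \<union> Q) W (outer v v) = entry_ip R (\<lambda>p. W p - G p) (outer v v)
      + entry_ip Q W (outer (\<lambda>l. v l + (\<Sum>i\<in>R. v i * K i l)) (\<lambda>l. v l + (\<Sum>i\<in>R. v i * K i l)))" for v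
  proof -
    define u where "u l = (\<Sum>i\<in>R. v i * K i l)" for l
    define B where "B l = (\<Sum>i\<in>R. W (l, i) * v i)" for l
    have B: "B l = (\<Sum>l'\<in>Q. W (l, l') * u l')" if "l \<in> Q" for l
    proof -
      have "B l = (\<Sum>i\<in>R. \<Sum>l'\<in>Q. W (l, l') * (v i * K i l'))"
        unfolding B_def
        by (rule sum.cong)
          (auto simp: WQR that sum_distrib_left symQ mult.commute mult.left_commute intro!: sum.cong)
      also have "\<dots> = (\<Sum>l'\<in>Q. W (l, l') * u l')"
        by (subst sum.swap) (simp add: u_def sum_distrib_left)
      finally show ?thesis .
    qed
    have "entry_ip R G (outer v v) = (\<Sum>i\<in>R. \<Sum>l\<in>Q. v i * K i l * B l)"
      unfolding entry_ip_outer
    proof (rule sum.cong)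
      fix i assume "i \<in> R"
      have "(\<Sum>j\<in>R. G (i, j) * v j) = (\<Sum>j\<in>R. \<Sum>l\<in>Q. K i l * (W (l, j) * v j))"
        by (simp add: G_def sum_distrib_right mult.assoc)
      also have "\<dots> = (\<Sum>l\<in>Q. K i l * B l)"
        by (subst sum.swap) (simp add: B_def sum_distrib_left)
      finally show "v i * (\<Sum>j\<in>R. G (i, j) * v j) = (\<Sum>l\<in>Q. v i * K i l * B l)"
        by (simp add: sum_distrib_left mult.assoc)
    qed simp
    also have "\<dots> = (\<Sum>l\<in>Q. u l * B l)"
      by (subst sum.swap) (simp add: u_def sum_distrib_right)
    also have "\<dots> = entry_ip Q W (outer u u)"
      unfolding entry_ip_outer by (simp add: B)
    finally have G: "entry_ip R G (outer v v) = entry_ip Q W (outer u u)" .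
    have vB: "entry_ip Q W (outer v u) = (\<Sum>l\<in>Q. v l * B l)"
      unfolding entry_ip_outer by (simp add: B)
    have vB': "entry_ip Q W (outer u v) = (\<Sum>l\<in>Q. v l * B l)"
    proof -
      have "outer u v = (\<lambda>(i, j). outer v u (j, i))" by (auto simp: outer_def)
      then have "entry_ip Q W (outer u v) = entry_ip Q (\<lambda>(i, j). W (j, i)) (outer v u)"
        by (simp add: entry_ip_swap)
      also have "\<dots> = entry_ip Q W (outer v u)"
        by (rule entry_ip_cong) (auto simp: symQ)
      finally show ?thesis using vB by simp
    qed
    have "outer (\<lambda>l. v l + u l) (\<lambda>l. v l + u l) =
        (\<lambda>p. outer v v p + outer v u p + outer u v p + outer u u p)"
      by (auto simp: outer_def algebra_simps)
    then have Q: "entry_ip Q W (outer (\<lambda>l. v l + u l) (\<lambda>l. v l + u l)) =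
        entry_ip Q W (outer v v) + 2 * (\<Sum>l\<in>Q. v l * B l) + entry_ip Q W (outer u u)"
      by (simp add: vB vB')
    have cross: "(\<Sum>i\<in>R. v i * (\<Sum>j\<in>Q. W (i, j) * v j)) = (\<Sum>l\<in>Q. v l * B l)"
    proof -
      have "(\<Sum>i\<in>R. v i * (\<Sum>j\<in>Q. W (i, j) * v j)) = (\<Sum>i\<in>R. \<Sum>j\<in>Q. v j * (W (j, i) * v i))"
        unfolding sum_distrib_left
        by (intro sum.cong) (use symmetric_onD[OF sym] in auto)
      also have "\<dots> = (\<Sum>l\<in>Q. v l * B l)"
        by (subst sum.swap) (simp add: B_def sum_distrib_left)
      finally show ?thesis .
    qed
    have "entry_ip (R \<union> Q) W (outer v v) = entry_ip R W (outer v v)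
        + (\<Sum>i\<in>R. v i * (\<Sum>j\<in>Q. W (i, j) * v j)) + (\<Sum>l\<in>Q. v l * B l) + entry_ip Q W (outer v v)"
      unfolding entry_ip_outer B_def using fin disj
      by (simp add: sum.union_disjoint sum.distrib distrib_left)
    then show ?thesis
      using G Q cross unfolding u_def by simp
  qed
  define Z :: "'a \<times> 'a \<Rightarrow> real" where "Z p = (if p \<in> R \<times> R then id_entries p else 0)" for p
  have Zip: "entry_ip (R \<union> Q) Z (outer v v) = entry_ip R id_entries (outer v v)" for v
    unfolding entry_ip_def Z_def
    by (rule sum.mono_neutral_cong_right) (use fin in auto)
  have "symmetric_on (R \<union> Q) Z" by (auto simp: symmetric_on_def Z_def id_entries_def)
  \<comment> \<open>The step size is \<open>1 / t\<close>, where \<open>t\<close> makes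
    \<open>W - G\<close> plus \<open>t\<close> times the identity psd on \<open>R\<close>; dividing
    by \<open>t\<close> moves the weight onto \<open>W\<close>.\<close>
  then have "symmetric_on (R \<union> Q) (\<lambda>p. Z p + (1 / t) * W p)"
    by (intro symmetric_on_lincomb sym)
  moreover have "0 \<le> entry_ip (R \<union> Q) (\<lambda>p. Z p + (1 / t) * W p) (outer v v)" for v
  proof -
    have "0 \<le> entry_ip R (\<lambda>p. (W p - G p) + t * id_entries p) (outer v v)"
      by (rule psd_on_quadratic[OF t(2)])
    then have "0 \<le> entry_ip (R \<union> Q) W (outer v v) + t * entry_ip (R \<union> Q) Z (outer v v)"
      unfolding quad Zip using psd_on_quadratic[OF psd, of "\<lambda>l. v l + (\<Sum>i\<in>R. v i * K i l)"]
      by simp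
    then have "0 \<le> (1 / t) * (entry_ip (R \<union> Q) W (outer v v) + t * entry_ip (R \<union> Q) Z (outer v v))"
      using t(1) by simp
    then show ?thesis using t(1) by (simp add: field_simps)
  qed
  ultimately have "psd_on (R \<union> Q) (\<lambda>p. Z p + (1 / t) * W p)" by (simp add: psd_on_def)
  then show ?thesis using t(1) unfolding Z_def by (intro exI[of _ "1 / t"]) simp
qed

section \<open>Semidefiniteness and rank of matrices\<close>

lemma psd_on_extend:
  assumes fin: "finite N" and sub: "R \<subseteq> N" and psd: "psd_on R X"
  shows "psd_on N (\<lambda>p. if p \<in> R \<times> R then X p else 0)"
proof -
  have "entry_ip N (\<lambda>p. if p \<in> R \<times> R then X p else 0) (outer v v) = entry_ip R X (outer v v)" for v
    unfolding entry_ip_def by (rule sum.mono_neutral_cong_right) (use fin sub in auto)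
  then show ?thesis
    using psd by (auto simp: psd_on_def symmetric_on_def)
qed

lemma psd_on_reindex:
  assumes "inj_on f S"
  shows "psd_on (f ` S) X \<longleftrightarrow> psd_on S (\<lambda>(i, j). X (f i, f j))"
proof -
  have ip: "entry_ip (f ` S) X (outer v v) =
      entry_ip S (\<lambda>(i, j). X (f i, f j)) (outer (v \<circ> f) (v \<circ> f))" for v
    unfolding entry_ip_outer by (simp add: sum.reindex[OF assms])
  have ip': "entry_ip S (\<lambda>(i, j). X (f i, f j)) (outer v v) =
      entry_ip (f ` S) X (outer (v \<circ> inv_into S f) (v \<circ> inv_into S f))" for v
    unfolding ip by (rule entry_ip_cong) (simp_all add: outer_def inv_into_f_f[OF assms])
  show ?thesis
    unfolding psd_on_def
  proof (intro conj_cong)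
    show "symmetric_on (f ` S) X = symmetric_on S (\<lambda>(i, j). X (f i, f j))"
      by (simp add: symmetric_on_def)
    show "(\<forall>v. 0 \<le> entry_ip (f ` S) X (outer v v)) \<longleftrightarrow>
        (\<forall>v. 0 \<le> entry_ip S (\<lambda>(i, j). X (f i, f j)) (outer v v))"
    proof (intro iffI allI)
      fix v assume "\<forall>v. 0 \<le> entry_ip (f ` S) X (outer v v)"
      then show "0 \<le> entry_ip S (\<lambda>(i, j). X (f i, f j)) (outer v v)"
        by (simp only: ip')
    next
      fix v assume "\<forall>v. 0 \<le> entry_ip S (\<lambda>(i, j). X (f i, f j)) (outer v v)"
      then show "0 \<le> entry_ip (f ` S) X (outer v v)"
        by (simp only: ip)
    qed
  qed
qed

section \<open>Passage from matrices to entry functions\<close>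

lemma psd_mat_iff_psd_on:
  assumes M: "M \<in> carrier_mat n n"
  shows "psd_mat n M \<longleftrightarrow> psd_on {..<n} (\<lambda>p. M $$ p)"
proof -
  have "M\<^sup>T = M \<longleftrightarrow> symmetric_on {..<n} (\<lambda>p. M $$ p)"
  proof
    assume "M\<^sup>T = M"
    then show "symmetric_on {..<n} (\<lambda>p. M $$ p)"
      unfolding symmetric_on_def using M by (metis carrier_matD index_transpose_mat(1) lessThan_iff)
  next
    assume "symmetric_on {..<n} (\<lambda>p. M $$ p)"
    then show "M\<^sup>T = M" using M by (intro eq_matI) (auto simp: symmetric_on_def)
  qed
  moreover have quad: "v \<bullet> (M *\<^sub>v v) = entry_ip {..<n} (\<lambda>p. M $$ p) (outer (($) v) (($) v))"
    if "v \<in> carrier_vec n" for v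
    unfolding entry_ip_outer using M that
    by (auto simp: scalar_prod_def lessThan_atLeast0 intro!: sum.cong)
  have "(\<forall>v\<in>carrier_vec n. 0 \<le> v \<bullet> (M *\<^sub>v v)) \<longleftrightarrow>
      (\<forall>v. 0 \<le> entry_ip {..<n} (\<lambda>p. M $$ p) (outer v v))"
  proof
    assume *: "\<forall>v\<in>carrier_vec n. 0 \<le> v \<bullet> (M *\<^sub>v v)"
    show "\<forall>v. 0 \<le> entry_ip {..<n} (\<lambda>p. M $$ p) (outer v v)"
    proof
      fix v
      have "entry_ip {..<n} (\<lambda>p. M $$ p) (outer (($) (vec n v)) (($) (vec n v))) =
          entry_ip {..<n} (\<lambda>p. M $$ p) (outer v v)"
        by (rule entry_ip_cong) (auto simp: outer_def)
      then show "0 \<le> entry_ip {..<n} (\<lambda>p. M $$ p) (outer v v)"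
        using * quad[of "vec n v"] by (metis vec_carrier)
    qed
  qed (use quad in auto)
  ultimately show ?thesis
    using M by (simp add: psd_mat_def sym_mat_def psd_on_def)
qed

lemma mat_ip_eq_entry_ip:
  assumes "X \<in> carrier_mat n n" "Y \<in> carrier_mat n n" "symmetric_on {..<n} (\<lambda>p. Y $$ p)"
  shows "mat_ip X Y = entry_ip {..<n} (\<lambda>p. X $$ p) (\<lambda>p. Y $$ p)"
proof -
  have "mat_ip X Y = (\<Sum>i<n. \<Sum>j<n. X $$ (i, j) * Y $$ (j, i))"
    using assms(1,2)
    by (auto simp: mat_ip_def mat_trace_def scalar_prod_def lessThan_atLeast0 intro!: sum.cong)
  also have "\<dots> = entry_ip {..<n} (\<lambda>p. X $$ p) (\<lambda>p. Y $$ p)"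
    unfolding entry_ip_def sum.cartesian_product
    by (rule sum.cong) (use assms(3) in \<open>auto simp: symmetric_on_def\<close>)
  finally show ?thesis .
qed

section \<open>Rank bounds through columns\<close>

context vec_space
begin

lemma rank_ge_card_independent_cols:
  assumes T: "T \<in> carrier_mat n nc" and J: "J \<subseteq> {..<nc}"
    and indep: "\<And>u. \<forall>i<n. (\<Sum>j\<in>J. u j * T $$ (i, j)) = 0 \<Longrightarrow> \<forall>j\<in>J. u j = 0"
  shows "card J \<le> rank T"
proof -
  have fin: "finite J" using J finite_subset by blast
  \<comment> \<open>Linear independence concerns the set of columns, so repeated columns must be
    excluded. A repetition would be a relation with coefficients 1 and - 1.\<close>
  have inj: "inj_on (col T) J"
  proof (rule inj_onI, rule ccontr)
    fix a b assume ab: "a \<in> J" "b \<in> J" "col T a = col T b" "a \<noteq> b"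
    let ?u = "\<lambda>j. (if j = a then 1 else 0) - (if j = b then 1 else (0::'a))"
    have "(\<Sum>j\<in>J. ?u j * T $$ (i, j)) = 0" if "i < n" for i
    proof -
      have "(\<Sum>j\<in>J. ?u j * T $$ (i, j)) =
          (\<Sum>j\<in>J. (if j = a then T $$ (i, j) else 0) - (if j = b then T $$ (i, j) else 0))"
        by (rule sum.cong) auto
      also have "\<dots> = T $$ (i, a) - T $$ (i, b)"
        using fin ab by (simp add: sum_subtractf)
      also have "\<dots> = col T a $ i - col T b $ i"
        using T that ab(1,2) J by (auto simp: subset_iff)
      finally show ?thesis using ab(3) by simp
    qed
    then have "?u a = 0" using indep[of ?u] ab(1) by blast
    then show False using ab(4) by simp
  qed
  have sub: "col T ` J \<subseteq> set (cols T)"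
    using T J by (auto simp: cols_def)
  have car: "col T ` J \<subseteq> carrier_vec n" using T by auto
  have "lin_indpt (col T ` J)"
  proof
    assume "lin_dep (col T ` J)"
    then obtain a v where av: "lincomb a (col T ` J) = 0\<^sub>v n" "v \<in> col T ` J" "a v \<noteq> 0"
      using finite_lin_dep[of "col T ` J"] fin car by auto
    have "(\<Sum>j\<in>J. a (col T j) * T $$ (i, j)) = 0" if "i < n" for i
    proof -
      have "(\<Sum>j\<in>J. a (col T j) * T $$ (i, j)) = (\<Sum>x\<in>col T ` J. a x * x $ i)"
        unfolding sum.reindex[OF inj] using T that J by (auto intro!: sum.cong simp: subset_iff)
      also have "\<dots> = 0" using lincomb_index[OF that car, of a] av(1) that by simp
      finally show ?thesis .
    qed
    then show False using indep[of "\<lambda>j. a (col T j)"] av(2,3) by blast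
  qed
  from rank_ge_card_indpt[OF T sub this] show ?thesis by (simp add: card_image[OF inj])
qed

text \<open>A maximal independent set of columns avoids the zero vector, so it lies among the first
  \<open>r\<close> columns.\<close>

lemma rank_le_if_cols_zero:
  assumes T: "T \<in> carrier_mat n nc" and zero: "\<And>j. r \<le> j \<Longrightarrow> j < nc \<Longrightarrow> col T j = 0\<^sub>v n"
  shows "rank T \<le> r"
proof -
  obtain S where max: "maximal S (\<lambda>U. U \<subseteq> set (cols T) \<and> lin_indpt U)"
    using maximal_exists[of "(\<lambda>U. U \<subseteq> set (cols T) \<and> lin_indpt U)" "card (set (cols T))" "{}"]
    by (meson List.finite_set card_mono empty_iff empty_subsetI finite_lin_indpt2 rev_finite_subset)
  then have S: "S \<subseteq> set (cols T)" "lin_indpt S" by (auto simp: maximal_def)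
  have "0\<^sub>v n \<notin> S"
  proof
    assume "0\<^sub>v n \<in> S"
    moreover have "S \<subseteq> carrier_vec n" using S(1) T cols_dim by blast
    moreover have "UNIV \<noteq> {0::'a}" by (metis UNIV_I singletonD zero_neq_one)
    ultimately show False using zero_nin_lin_indpt[OF _ S(2)] by auto
  qed
  have "S \<subseteq> col T ` {..<r}"
  proof
    fix x assume x: "x \<in> S"
    then obtain j where j: "j < nc" "x = col T j" using S(1) T by (auto simp: cols_def)
    then have "j < r" using zero \<open>0\<^sub>v n \<notin> S\<close> x by (metis not_le)
    then show "x \<in> col T ` {..<r}" using j by blast
  qed
  then have "card S \<le> card (col T ` {..<r})" by (intro card_mono) auto
  also have "\<dots> \<le> r" using card_image_le[of "{..<r}" "col T"] by simp
  finally show ?thesis using rank_card_indpt[OF T max] by simp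
qed

end

section \<open>Systems with a block-diagonal maximum rank slack\<close>

locale max_rank_slack_block =
  fixes n m r :: nat and A :: "nat \<Rightarrow> real mat" and B :: "real mat"
  assumes A_sym: "\<And>i. i < m \<Longrightarrow> sym_mat n (A i)"
    and B_sym: "sym_mat n B"
    and r_le: "r \<le> n"
    and Z_max: "is_max_rank_slack n m A B
      (four_block_mat (1\<^sub>m r) (0\<^sub>m r (n - r)) (0\<^sub>m (n - r) r) (0\<^sub>m (n - r) (n - r)))"
begin

abbreviation "Z \<equiv> four_block_mat (1\<^sub>m r :: real mat) (0\<^sub>m r (n - r)) (0\<^sub>m (n - r) r) (0\<^sub>m (n - r) (n - r))"

abbreviation "R \<equiv> {..<r}"
abbreviation "Q \<equiv> {r..<n}"
abbreviation "N \<equiv> {..<n}"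

text \<open>Coefficients are functions, so they add and scale pointwise; \<open>W_vec\<close> leads
  back to vectors of dimension \<open>m\<close>.\<close>

definition W :: "(nat \<Rightarrow> real) \<Rightarrow> nat \<times> nat \<Rightarrow> real" where
  "W x p = (\<Sum>k<m. x k * A k $$ p)"

definition Zf :: "nat \<times> nat \<Rightarrow> real" where
  "Zf p = (if p \<in> R \<times> R then id_entries p else 0)"

lemma N_eq: "N = R \<union> Q" using r_le by auto

lemma A_carrier: "k < m \<Longrightarrow> A k \<in> carrier_mat n n"
  using A_sym by (simp add: sym_mat_def)

lemma B_carrier: "B \<in> carrier_mat n n"
  using B_sym by (simp add: sym_mat_def)

lemma A_symmetric_on: "k < m \<Longrightarrow> symmetric_on N (\<lambda>p. A k $$ p)"
  unfolding symmetric_on_def using A_sym[of k]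
  by (metis carrier_matD index_transpose_mat(1) lessThan_iff sym_mat_def)

lemma W_symmetric_on: "symmetric_on N (W x)"
  using symmetric_on_sum[of "{..<m}" N "\<lambda>k p. A k $$ p" x] A_symmetric_on unfolding W_def by simp

lemma W_add: "W (\<lambda>k. x k + y k) p = W x p + W y p"
  by (simp add: W_def algebra_simps sum.distrib)

lemma W_diff: "W (\<lambda>k. x k - y k) p = W x p - W y p"
  by (simp add: W_def algebra_simps sum_subtractf)

lemma W_scale: "W (\<lambda>k. a * x k) p = a * W x p"
  by (simp add: W_def algebra_simps sum_distrib_left)

lemma entry_ip_W: "entry_ip S (W x) Y = (\<Sum>k<m. x k * entry_ip S (\<lambda>p. A k $$ p) Y)"
  unfolding W_def entry_ip_sum_left ..

lemma mat_lincomb_index: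
  "p \<in> N \<times> N \<Longrightarrow> mat_lincomb n m A x $$ p = W (($) x) p"
  by (auto simp: mat_lincomb_def W_def)

lemma Z_index: "p \<in> N \<times> N \<Longrightarrow> Z $$ p = Zf p"
  using r_le by (cases p) (auto simp: Zf_def id_entries_def index_mat_four_block(1))

lemma Z_carrier: "Z \<in> carrier_mat n n"
  using r_le by (intro carrier_matI) auto

lemma W_vec: "W (($) (vec m x)) = W x"
  by (rule ext) (simp add: W_def)

lemma psd_mat_slack_iff:
  "psd_mat n (B - mat_lincomb n m A x) \<longleftrightarrow> psd_on N (\<lambda>p. B $$ p - W (($) x) p)"
proof -
  have car: "mat_lincomb n m A x \<in> carrier_mat n n" by (simp add: mat_lincomb_def)
  have eq: "(B - mat_lincomb n m A x) $$ (i, j) = B $$ (i, j) - W (($) x) (i, j)"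
    if "i \<in> N" "j \<in> N" for i j
    using that car mat_lincomb_index[of "(i, j)" x] by simp
  show ?thesis
    unfolding psd_mat_iff_psd_on[OF minus_carrier_mat[OF car]]
    using psd_on_cong[of N "\<lambda>p. (B - mat_lincomb n m A x) $$ p" "\<lambda>p. B $$ p - W (($) x) p"]
      psd_on_cong[of N "\<lambda>p. B $$ p - W (($) x) p" "\<lambda>p. (B - mat_lincomb n m A x) $$ p"] eq
    by auto
qed

text \<open>The shift that reduces to right-hand side \<open>Z\<close>: the slack at
  \<open>x\<close> becomes \<open>Zf\<close> plus \<open>W\<close> at the difference of
  \<open>x0\<close> and \<open>x\<close>.\<close>

lemma Z_slack: obtains x0 where "\<And>p. p \<in> N \<times> N \<Longrightarrow> B $$ p = Zf p + W x0 p"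
proof -
  obtain x where x: "Z = B - mat_lincomb n m A x"
    using Z_max unfolding is_max_rank_slack_def is_slack_def by blast
  have "B $$ p = Zf p + W (($) x) p" if "p \<in> N \<times> N" for p
  proof -
    have "Z $$ p = B $$ p - mat_lincomb n m A x $$ p"
      unfolding x using that by (auto simp: mat_lincomb_def)
    then show ?thesis using Z_index[OF that] mat_lincomb_index[OF that, of x] by simp
  qed
  then show thesis by (rule that)
qed

lemma rank_Z_le: "vec_space.rank n Z \<le> r"
proof -
  interpret vec_space "TYPE(real)" n .
  show ?thesis
  proof (rule rank_le_if_cols_zero[OF Z_carrier])
    fix j assume "r \<le> j" "j < n"
    then show "col Z j = 0\<^sub>v n"
      using r_le by (intro eq_vecI) auto
  qed
qed

section \<open>Slacks vanish outside the leading block\<close>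

lemma Zf_quadratic: "entry_ip N Zf (outer v v) = (\<Sum>i<r. (v i)\<^sup>2)"
proof -
  have "entry_ip N Zf (outer v v) = entry_ip R id_entries (outer v v)"
    unfolding entry_ip_def Zf_def
    by (rule sum.mono_neutral_cong_right) (use r_le in auto)
  also have "\<dots> = (\<Sum>i<r. (v i)\<^sup>2)"
    unfolding entry_ip_commute[of R id_entries] by (simp add: entry_ip_id outer_def power2_eq_square)
  finally show ?thesis .
qed

lemma psd_on_Zf: "psd_on N Zf"
  using psd_on_extend[of N R id_entries] psd_on_id[of R] r_le unfolding Zf_def by auto

text \<open>Otherwise the midpoint of \<open>Z\<close> and the slack would have rank greater than \<open>r\<close>.\<close>

lemma slack_in_face:
  assumes psd: "psd_on N (\<lambda>p. Zf p + W x p)" and i: "i < n" and j: "r \<le> j" "j < n"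
  shows "W x (i, j) = 0"
proof -
  obtain x0 where x0: "\<And>p. p \<in> N \<times> N \<Longrightarrow> B $$ p = Zf p + W x0 p"
    using Z_slack by blast
  let ?S = "\<lambda>p. Zf p + W x p"
  \<comment> \<open>Half of \<open>x\<close> makes \<open>T\<close> the midpoint of \<open>Z\<close>
    and the given slack.\<close>
  define y where "y = vec m (\<lambda>k. x0 k - (1/2) * x k)"
  define T where "T = B - mat_lincomb n m A y"
  have T: "T \<in> carrier_mat n n"
    unfolding T_def by (rule minus_carrier_mat) (simp add: mat_lincomb_def)
  have T_index: "T $$ p = (1/2) * Zf p + (1/2) * ?S p" if "p \<in> N \<times> N" for p
  proof -
    have "T $$ p = B $$ p - mat_lincomb n m A y $$ p"
      unfolding T_def using that by (auto simp: mat_lincomb_def)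
    also have "\<dots> = Zf p + W x0 p - W (\<lambda>k. x0 k - (1/2) * x k) p"
      unfolding x0[OF that] mat_lincomb_index[OF that] y_def W_vec ..
    finally show ?thesis by (simp only: W_diff W_scale) (simp add: field_simps)
  qed
  have "psd_on N (\<lambda>p. (1/2) * Zf p + (1/2) * ?S p)"
    by (intro psd_on_add[of N "\<lambda>p. (1/2) * Zf p"] psd_on_scale psd_on_Zf psd) auto
  then have psdT: "psd_on N (\<lambda>p. T $$ p)"
    by (rule psd_on_cong[rotated]) (use T_index in auto)
  then have "is_slack n m A B T"
    unfolding is_slack_def psd_mat_iff_psd_on[OF T] using T_def y_def by (metis vec_carrier)
  then have "vec_space.rank n T \<le> vec_space.rank n Z"
    using Z_max unfolding is_max_rank_slack_def by blast
  then have rank_T: "vec_space.rank n T \<le> r" using rank_Z_le by linarith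
  have Sjj: "W x (j, j) = 0"
  proof (rule ccontr)
    assume nz: "W x (j, j) \<noteq> 0"
    interpret vec_space "TYPE(real)" n .
    \<comment> \<open>Independence of the first \<open>r\<close> columns of \<open>T\<close>
      together with column \<open>j\<close> would give rank at least \<open>r + 1\<close>.\<close>
    have "card (insert j R) \<le> rank T"
    proof (rule rank_ge_card_independent_cols[OF T])
      show "insert j R \<subseteq> {..<n}" using j r_le by auto
      fix u :: "nat \<Rightarrow> real"
      assume u: "\<forall>i<n. (\<Sum>l\<in>insert j R. u l * T $$ (i, l)) = 0"
      define v where "v l = (if l \<in> insert j R then u l else 0)" for l
      have "(\<Sum>l<n. T $$ (i, l) * v l) = 0" if "i < n" for i
      proof -
        have "(\<Sum>l<n. T $$ (i, l) * v l) = (\<Sum>l\<in>insert j R. u l * T $$ (i, l))"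
          by (rule sum.mono_neutral_cong_right) (use j r_le in \<open>auto simp: v_def\<close>)
        then show ?thesis using u that by simp
      qed
      then have "entry_ip N (\<lambda>p. T $$ p) (outer v v) = 0"
        unfolding entry_ip_outer by simp
      moreover have "entry_ip N (\<lambda>p. T $$ p) (outer v v) =
          entry_ip N (\<lambda>p. (1/2) * Zf p + (1/2) * ?S p) (outer v v)"
        by (rule entry_ip_cong) (use T_index in auto)
      ultimately have "(1/2) * entry_ip N Zf (outer v v) + (1/2) * entry_ip N ?S (outer v v) = 0"
        by (simp only: entry_ip_left)
      then have sum0: "entry_ip N Zf (outer v v) + entry_ip N ?S (outer v v) = 0" by linarith
      \<comment> \<open>\<open>T\<close> annihilates \<open>v\<close>, so both psd halves have zero
        quadratic form at \<open>v\<close>. The first kills \<open>v\<close> on \<open>R\<close>;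
        the second then leaves only the \<open>j\<close>-th diagonal term.\<close>
      then have Z0: "entry_ip N Zf (outer v v) = 0" and S0: "entry_ip N ?S (outer v v) = 0"
        using psd_on_quadratic[OF psd_on_Zf, of v] psd_on_quadratic[OF psd, of v] by linarith+
      have vR: "v l = 0" if "l < r" for l
        using Z0 that unfolding Zf_quadratic by (simp add: sum_nonneg_eq_0_iff)
      have v0: "v l = 0" if "l \<noteq> j" for l
        using vR[of l] that by (cases "l < r") (auto simp: v_def)
      have "entry_ip N (W x) (outer v v) = v j * (W x (j, j) * v j)"
      proof -
        have "(\<Sum>l<n. W x (i, l) * v l) = W x (i, j) * v j" for i
          by (subst sum.mono_neutral_right[of _ "{j}"]) (use j v0 in auto)
        then have "entry_ip N (W x) (outer v v) = (\<Sum>i<n. v i * (W x (i, j) * v j))"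
          by (simp add: entry_ip_outer)
        also have "\<dots> = v j * (W x (j, j) * v j)"
          by (subst sum.mono_neutral_right[of _ "{j}"]) (use j v0 in auto)
        finally show ?thesis .
      qed
      then have "v j = 0" using S0 Z0 nz by simp
      then show "\<forall>l\<in>insert j R. u l = 0" using v0 unfolding v_def by metis
    qed
    then show False using rank_T j by simp
  qed
  have Z0: "Zf (j, l) = 0" for l using j by (simp add: Zf_def)
  \<comment> \<open>A psd matrix with a zero diagonal entry has a zero row there.\<close>
  have "Zf (j, i) + W x (j, i) = 0"
    by (rule psd_on_zero_diag[OF _ psd]) (use i j Sjj Z0 in auto)
  then show ?thesis
    using Z0 symmetric_onD[OF W_symmetric_on, of i j x] i j by simp
qed

section \<open>Dual attainment in the absence of a certificate\<close>

lemma regular_lincomb_zero: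
  assumes psd: "psd_on Q (W x)"
    and K: "\<And>i j. i \<in> R \<Longrightarrow> j \<in> Q \<Longrightarrow> W x (i, j) = (\<Sum>l\<in>Q. K i l * W x (l, j))"
    and i: "i < n" and j: "r \<le> j" "j < n"
  shows "W x (i, j) = 0"
proof -
  have disj: "R \<inter> Q = {}" by auto
  \<comment> \<open>The range condition makes a small step from \<open>Z\<close> along
    \<open>W x\<close> a slack again, to which \<open>slack_in_face\<close> applies.\<close>
  obtain e where e: "0 < e" "psd_on (R \<union> Q) (\<lambda>p. (if p \<in> R \<times> R then id_entries p else 0) + e * W x p)"
    using psd_on_block_perturbation[OF _ _ disj _ psd K] W_symmetric_on[of x] N_eq by auto
  have "psd_on N (\<lambda>p. Zf p + W (\<lambda>k. e * x k) p)"
    using e(2) unfolding N_eq[symmetric] Zf_def W_scale .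
  from slack_in_face[OF this i j] show ?thesis using e(1) by (simp add: W_scale)
qed

text \<open>\<open>NV\<close> says that no certificate exists: row \<open>i\<close> of the
  off-diagonal block is the combination of rows of the trailing block with coefficients
  \<open>K i\<close>. The dual solution is assembled from one matrix on \<open>R\<close> and one on
  \<open>Q\<close>.\<close>

lemma dual_attained:
  assumes NV: "\<And>x. psd_on Q (W x) \<Longrightarrow>
      \<exists>K. \<forall>i\<in>R. \<forall>j\<in>Q. W x (i, j) = (\<Sum>l\<in>Q. K i l * W x (l, j))"
    and pv: "sdp_primal_value n m A B c = ereal pv"
  shows "\<exists>Y\<in>sdp_dual_feasible_set n m A c. mat_ip B Y = pv"
proof -
  obtain x0 where x0: "\<And>p. p \<in> N \<times> N \<Longrightarrow> B $$ p = Zf p + W x0 p"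
    using Z_slack by blast
  define cx where "cx x = (\<Sum>k<m. c $ k * x k)" for x
  have cx_add: "cx (\<lambda>k. x k + y k) = cx x + cx y" for x y
    by (simp add: cx_def algebra_simps sum.distrib)
  have cx_diff: "cx (\<lambda>k. x k - y k) = cx x - cx y" for x y
    by (simp add: cx_def algebra_simps sum_subtractf)
  have cx_scale: "cx (\<lambda>k. a * x k) = a * cx x" for a x
    by (simp add: cx_def sum_distrib_left mult.left_commute)
  define val where "val = pv - cx x0"
  \<comment> \<open>The combinations supported on the leading block. By
    \<open>slack_in_face\<close>, feasible points differ from \<open>x0\<close> by elements of
    \<open>D\<close>, so the constraint on \<open>R\<close> is all that remains.\<close>
  define D where "D = {x. \<forall>i\<in>N. \<forall>j\<in>Q. W x (i, j) = 0}"
  have D_add: "(\<lambda>k. x k + y k) \<in> D" if "x \<in> D" "y \<in> D" for x y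
    using that by (simp add: D_def W_add)
  have D_scale: "(\<lambda>k. a * x k) \<in> D" if "x \<in> D" for a x
    using that by (simp add: D_def W_scale)
  have D_zero: "W x p = 0" if "x \<in> D" "p \<in> N \<times> N" "p \<notin> R \<times> R" for x p
  proof -
    obtain i j where p: "p = (i, j)" by fastforce
    show ?thesis
      using that symmetric_onD[OF W_symmetric_on, of i j x] unfolding p D_def by auto
  qed
  \<comment> \<open>Together with \<open>least\<close> this identifies \<open>val\<close> as the
    supremum of the problem restricted to \<open>D\<close> and \<open>R\<close>.\<close>
  have upper: "cx y \<le> val" if yD: "y \<in> D" and psd: "psd_on R (\<lambda>p. id_entries p - W y p)" for y
  proof -
    have "psd_on N (\<lambda>p. if p \<in> R \<times> R then id_entries p - W y p else 0)"
      by (rule psd_on_extend[OF _ _ psd]) (use r_le in auto)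
    then have "psd_on N (\<lambda>p. B $$ p - W (\<lambda>k. x0 k + y k) p)"
      by (rule psd_on_cong[rotated]) (use D_zero[OF yD] x0 in \<open>auto simp: W_add Zf_def\<close>)
    then have "psd_on N (\<lambda>p. B $$ p - W (($) (vec m (\<lambda>k. x0 k + y k))) p)"
      unfolding W_vec .
    then have "vec m (\<lambda>k. x0 k + y k) \<in> sdp_feasible_set n m A B"
      unfolding sdp_feasible_set_def loewner_le_def using psd_mat_slack_iff by simp
    then have "ereal (\<Sum>k<m. c $ k * vec m (\<lambda>k. x0 k + y k) $ k) \<le> ereal pv"
      unfolding pv[symmetric] sdp_primal_value_def by (rule SUP_upper)
    then have "cx (\<lambda>k. x0 k + y k) \<le> pv" by (simp add: cx_def)
    then show ?thesis by (simp add: cx_add val_def)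
  qed
  have least: "val \<le> q" if q: "\<And>y. y \<in> D \<Longrightarrow> psd_on R (\<lambda>p. id_entries p - W y p) \<Longrightarrow> cx y \<le> q" for q
  proof -
    have "ereal pv \<le> ereal (cx x0 + q)"
      unfolding pv[symmetric] sdp_primal_value_def
    proof (rule SUP_least)
      fix x assume "x \<in> sdp_feasible_set n m A B"
      then have psd: "psd_on N (\<lambda>p. B $$ p - W (($) x) p)"
        unfolding sdp_feasible_set_def loewner_le_def using psd_mat_slack_iff by simp
      have psd1: "psd_on N (\<lambda>p. Zf p + W (\<lambda>k. x0 k - x $ k) p)"
        by (rule psd_on_cong[OF _ psd]) (use x0 in \<open>auto simp: W_diff\<close>)
      define y where "y = (\<lambda>k. x $ k - x0 k)"
      have Wy: "W y p = - W (\<lambda>k. x0 k - x $ k) p" for p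
        by (simp add: y_def W_diff)
      have yD: "y \<in> D"
        using slack_in_face[OF psd1] by (auto simp: D_def Wy)
      have "psd_on R (\<lambda>p. Zf p + W (\<lambda>k. x0 k - x $ k) p)"
        by (rule psd_on_subset[OF _ _ psd1]) (use r_le in auto)
      then have "psd_on R (\<lambda>p. id_entries p - W y p)"
        by (rule psd_on_cong[rotated]) (auto simp: Wy Zf_def)
      from q[OF yD this] have "cx (\<lambda>k. x $ k) \<le> cx x0 + q"
        unfolding y_def cx_diff by simp
      then show "ereal (\<Sum>i<m. c $ i * x $ i) \<le> ereal (cx x0 + q)" by (simp add: cx_def)
    qed
    then show ?thesis by (simp add: val_def)
  qed
  have recession: "cx x \<le> 0" if xD: "x \<in> D" and psd: "psd_on R (\<lambda>p. - W x p)" for x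
  proof (rule ccontr)
    assume pos: "\<not> cx x \<le> 0"
    \<comment> \<open>Chosen so that \<open>s * cx x\<close> equals
      \<open>\<bar>val\<bar> + 1\<close>, which exceeds the upper bound \<open>val\<close>.\<close>
    define s where "s = (\<bar>val\<bar> + 1) / cx x"
    have "0 \<le> s" using pos by (simp add: s_def)
    have "psd_on R (\<lambda>p. id_entries p + s * - W x p)"
      by (rule psd_on_add[OF psd_on_id psd_on_scale[OF \<open>0 \<le> s\<close> psd]]) simp
    then have "psd_on R (\<lambda>p. id_entries p - W (\<lambda>k. s * x k) p)" by (simp add: W_scale)
    from upper[OF D_scale[OF xD] this] have "s * cx x \<le> val" by (simp add: cx_scale)
    then show False using pos by (simp add: s_def)
  qed
  have bound: "cx x \<le> t * val" if xD: "x \<in> D" and psd: "psd_on R (\<lambda>p. t * id_entries p - W x p)" for t x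
  proof -
    consider "t = 0" | "t > 0" | "t < 0" by linarith
    then show ?thesis
    proof cases
      case 1
      then show ?thesis using recession[OF xD] psd by simp
    next
      case 2
      have "psd_on R (\<lambda>p. (1 / t) * (t * id_entries p - W x p))"
        by (rule psd_on_scale[OF _ psd]) (use 2 in simp)
      moreover have "(\<lambda>p. (1 / t) * (t * id_entries p - W x p)) =
          (\<lambda>p. id_entries p - W (\<lambda>k. (1 / t) * x k) p)"
        unfolding W_scale using 2 by (simp add: field_simps)
      ultimately have "cx (\<lambda>k. (1 / t) * x k) \<le> val" using upper[OF D_scale[OF xD]] by metis
      then have "(1 / t) * cx x \<le> val" unfolding cx_scale .
      then show ?thesis using 2 by (simp add: field_simps)
    next
      case 3
      \<comment> \<open>For negative \<open>t\<close>, adding this to the slack of any feasible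
        \<open>y\<close> shows that \<open>y - x / t\<close> is a recession direction. So
        \<open>cx x / t\<close> bounds the objective, and multiplication by \<open>t\<close>
        reverses the inequality.\<close>
      have psd1: "psd_on R (\<lambda>p. (- 1 / t) * (t * id_entries p - W x p))"
        by (rule psd_on_scale[OF _ psd]) (use 3 in \<open>simp add: field_simps\<close>)
      have "val \<le> (1 / t) * cx x"
      proof (rule least)
        fix y assume yD: "y \<in> D" and psd_y: "psd_on R (\<lambda>p. id_entries p - W y p)"
        have "psd_on R (\<lambda>p. - W (\<lambda>k. y k + (- 1 / t) * x k) p)"
          by (rule psd_on_cong[OF _ psd_on_add[OF psd_y psd1]])
            (use 3 in \<open>simp only: W_add W_scale, simp add: field_simps\<close>)
        from recession[OF D_add[OF yD D_scale[OF xD]] this] have "cx y + (- 1 / t) * cx x \<le> 0"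
          unfolding cx_add cx_scale .
        then show "cx y \<le> (1 / t) * cx x" by simp
      qed
      then have "t * ((1 / t) * cx x) \<le> t * val" using 3 by (intro mult_left_mono_neg) auto
      then show ?thesis using 3 by simp
    qed
  qed
  have "\<exists>Y. psd_on R Y \<and> entry_ip R id_entries Y = val \<and>
    (\<forall>x\<in>D. (\<Sum>k<m. x k * entry_ip R (\<lambda>p. A k $$ p) Y) = (\<Sum>k<m. c $ k * x k))"
  proof (rule psd_dual_solution_slater)
    show "symmetric_on R (\<lambda>p. A k $$ p)" if "k < m" for k
      using A_symmetric_on[OF that] r_le by (auto simp: symmetric_on_def)
    have "(\<lambda>k. 0) \<in> D" by (simp add: D_def W_def)
    then show "D \<noteq> {}" by blast
    show "(\<Sum>k<m. c $ k * x k) \<le> t * val"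
      if "x \<in> D" "psd_on R (\<lambda>p. t * id_entries p - (\<Sum>k<m. x k * A k $$ p))" for t x
      using bound[OF that(1), of t] that(2) unfolding W_def cx_def by blast
  qed (use D_add D_scale in auto)
  then obtain Y1 where Y1: "psd_on R Y1" "entry_ip R id_entries Y1 = val"
    "\<And>x. x \<in> D \<Longrightarrow> (\<Sum>k<m. x k * entry_ip R (\<lambda>p. A k $$ p) Y1) = cx x"
    unfolding cx_def by blast
  \<comment> \<open>The part of \<open>c\<close> that \<open>Y1\<close> leaves unmatched; it
    vanishes on \<open>D\<close>. A combination with zero trailing block is in \<open>D\<close> by
    \<open>W_zero\<close>, so \<open>g\<close> depends on trailing blocks alone.\<close>
  define g where "g k = c $ k - entry_ip R (\<lambda>p. A k $$ p) Y1" for k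
  have W_zero: "x \<in> D" if psd: "psd_on Q (W x)" for x
  proof -
    obtain K where "\<And>i j. i \<in> R \<Longrightarrow> j \<in> Q \<Longrightarrow> W x (i, j) = (\<Sum>l\<in>Q. K i l * W x (l, j))"
      using NV[OF psd] by blast
    from regular_lincomb_zero[OF psd this] show ?thesis by (auto simp: D_def)
  qed
  have "\<exists>Y. psd_on Q Y \<and> (\<forall>k<m. entry_ip Q (\<lambda>p. A k $$ p) Y = g k)"
  proof (rule psd_dual_solution_if_no_psd_lincomb)
    show "symmetric_on Q (\<lambda>p. A k $$ p)" if "k < m" for k
      using A_symmetric_on[OF that] by (auto simp: symmetric_on_def)
  next
    fix x assume "psd_on Q (\<lambda>p. \<Sum>k<m. x k * A k $$ p)"
    then have "x \<in> D" using W_zero[of x] unfolding W_def by blast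
    then have "\<forall>p\<in>Q \<times> Q. W x p = 0" using D_zero by auto
    then show "\<forall>p\<in>Q \<times> Q. (\<Sum>k<m. x k * A k $$ p) = 0" unfolding W_def .
  next
    fix x assume "\<forall>p\<in>Q \<times> Q. (\<Sum>k<m. x k * A k $$ p) = 0"
    then have "psd_on Q (W x)"
      by (intro psd_on_cong[OF _ psd_on_zero]) (auto simp: W_def)
    then have "(\<Sum>k<m. x k * entry_ip R (\<lambda>p. A k $$ p) Y1) = cx x"
      by (intro Y1(3) W_zero)
    then show "(\<Sum>k<m. g k * x k) = 0"
      by (simp add: g_def cx_def right_diff_distrib sum_subtractf mult.commute)
  qed simp
  then obtain Y2 where Y2: "psd_on Q Y2" "\<And>k. k < m \<Longrightarrow> entry_ip Q (\<lambda>p. A k $$ p) Y2 = g k"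
    by blast
  \<comment> \<open>The block \<open>Y1\<close> gives the value against \<open>Z\<close>, while
    \<open>Y2\<close> supplies exactly the residual \<open>g\<close> in the equations.\<close>
  define Yf where "Yf p = (if p \<in> R \<times> R then Y1 p else 0) + (if p \<in> Q \<times> Q then Y2 p else 0)" for p
  define Y where "Y = mat n n Yf"
  have Y: "Y \<in> carrier_mat n n" by (simp add: Y_def)
  have "psd_on N Yf"
    unfolding Yf_def
    by (intro psd_on_add[of N "\<lambda>p. if p \<in> R \<times> R then Y1 p else 0"] psd_on_extend Y1(1) Y2(1))
      (use r_le in auto)
  then have psdY: "psd_on N (\<lambda>p. Y $$ p)"
    by (rule psd_on_cong[rotated]) (simp add: Y_def)
  have ip: "entry_ip N X (\<lambda>p. Y $$ p) = entry_ip R X Y1 + entry_ip Q X Y2" for X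
  proof -
    have "entry_ip N X (\<lambda>p. Y $$ p) = entry_ip N X Yf"
      by (rule entry_ip_cong) (auto simp: Y_def)
    also have "\<dots> = entry_ip N X (\<lambda>p. if p \<in> R \<times> R then Y1 p else 0)
        + entry_ip N X (\<lambda>p. if p \<in> Q \<times> Q then Y2 p else 0)"
      unfolding Yf_def by (simp only: entry_ip_right)
    also have "entry_ip N X (\<lambda>p. if p \<in> R \<times> R then Y1 p else 0) = entry_ip R X Y1"
      unfolding entry_ip_def by (rule sum.mono_neutral_cong_right) (use r_le in auto)
    also have "entry_ip N X (\<lambda>p. if p \<in> Q \<times> Q then Y2 p else 0) = entry_ip Q X Y2"
      unfolding entry_ip_def by (rule sum.mono_neutral_cong_right) auto
    finally show ?thesis .
  qed
  have ipA: "entry_ip N (\<lambda>p. A k $$ p) (\<lambda>p. Y $$ p) = c $ k" if "k < m" for k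
    unfolding ip Y2(2)[OF that] by (simp add: g_def)
  have "mat_ip (A k) Y = c $ k" if "k < m" for k
    using mat_ip_eq_entry_ip[OF A_carrier[OF that] Y psd_on_sym[OF psdY]] ipA[OF that] by simp
  then have feas: "Y \<in> sdp_dual_feasible_set n m A c"
    using psdY by (simp add: sdp_dual_feasible_set_def psd_mat_iff_psd_on[OF Y])
  have "mat_ip B Y = entry_ip N (\<lambda>p. B $$ p) (\<lambda>p. Y $$ p)"
    by (rule mat_ip_eq_entry_ip[OF B_carrier Y psd_on_sym[OF psdY]])
  also have "\<dots> = entry_ip N (\<lambda>p. Zf p + W x0 p) (\<lambda>p. Y $$ p)"
    by (rule entry_ip_cong) (use x0 in auto)
  also have "\<dots> = entry_ip N Zf (\<lambda>p. Y $$ p) + cx x0"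
    by (simp add: entry_ip_W ipA cx_def mult.commute)
  also have "entry_ip N Zf (\<lambda>p. Y $$ p) = entry_ip R Zf Y1 + entry_ip Q Zf Y2" by (rule ip)
  also have "entry_ip R Zf Y1 = entry_ip R id_entries Y1"
    by (rule entry_ip_cong) (auto simp: Zf_def)
  also have "entry_ip Q Zf Y2 = entry_ip Q (\<lambda>p. 0) Y2"
    by (rule entry_ip_cong) (auto simp: Zf_def)
  finally have "mat_ip B Y = pv" by (simp add: Y1(2) val_def)
  then show ?thesis using feas by blast
qed

section \<open>Bad behaviour from a nonzero off-diagonal block\<close>

lemma badly_behaved_if_offdiag:
  assumes psd: "psd_on Q (W x)" and nz: "i \<in> R" "j \<in> Q" "W x (i, j) \<noteq> 0"
  shows "badly_behaved n m A B"
proof -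
  obtain x0 where x0: "\<And>p. p \<in> N \<times> N \<Longrightarrow> B $$ p = Zf p + W x0 p"
    using Z_slack by blast
  \<comment> \<open>Support off the diagonal blocks makes the objective blind to differences of
    feasible points. The minus sign makes its pairing with \<open>W x\<close> strictly
    negative.\<close>
  define Yf where "Yf p = (if p \<in> R \<times> Q \<union> Q \<times> R then - W x p else 0)" for p
  define c where "c = vec m (\<lambda>k. entry_ip N (\<lambda>p. A k $$ p) Yf)"
  have cx: "(\<Sum>k<m. c $ k * y k) = entry_ip N (W y) Yf" for y
    by (simp add: entry_ip_W c_def mult.commute)
  have const: "(\<Sum>k<m. c $ k * y $ k) = (\<Sum>k<m. c $ k * x0 k)"
    if "y \<in> sdp_feasible_set n m A B" for y
  proof -
    have psd: "psd_on N (\<lambda>p. B $$ p - W (($) y) p)"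
      using that unfolding sdp_feasible_set_def loewner_le_def using psd_mat_slack_iff by simp
    have psd1: "psd_on N (\<lambda>p. Zf p + W (\<lambda>k. x0 k - y $ k) p)"
      by (rule psd_on_cong[OF _ psd]) (use x0 in \<open>auto simp: W_diff\<close>)
    have z: "W (\<lambda>k. x0 k - y $ k) p * Yf p = 0" if p: "p \<in> N \<times> N" for p
    proof -
      obtain a b where ab: "p = (a, b)" by fastforce
      show ?thesis
      proof (cases "p \<in> R \<times> Q \<union> Q \<times> R")
        case True
        then have "W (\<lambda>k. x0 k - y $ k) (a, b) = 0"
          using slack_in_face[OF psd1, of a b] slack_in_face[OF psd1, of b a] p
            symmetric_onD[OF W_symmetric_on, of a b "\<lambda>k. x0 k - y $ k"]
          unfolding ab by auto
        then show ?thesis by (simp add: ab)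
      qed (simp add: Yf_def)
    qed
    have "entry_ip N (W (\<lambda>k. x0 k - y $ k)) Yf = 0"
      unfolding entry_ip_def by (rule sum.neutral) (use z in blast)
    then have "(\<Sum>k<m. c $ k * (x0 k - y $ k)) = 0" using cx by simp
    then show ?thesis by (simp add: right_diff_distrib sum_subtractf)
  qed
  have feas: "vec m x0 \<in> sdp_feasible_set n m A B"
  proof -
    have "psd_on N (\<lambda>p. B $$ p - W (($) (vec m x0)) p)"
      unfolding W_vec by (rule psd_on_cong[OF _ psd_on_Zf]) (use x0 in auto)
    then show ?thesis
      unfolding sdp_feasible_set_def loewner_le_def using psd_mat_slack_iff by simp
  qed
  have val: "sdp_primal_value n m A B c = ereal (\<Sum>k<m. c $ k * x0 k)"
    unfolding sdp_primal_value_def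
    by (rule SUP_eqI) (use const feas in \<open>auto simp del: ereal_less_eq\<close>)
  have "mat_ip B Y \<noteq> (\<Sum>k<m. c $ k * x0 k)" if Y: "Y \<in> sdp_dual_feasible_set n m A c" for Y
  proof
    assume eq: "mat_ip B Y = (\<Sum>k<m. c $ k * x0 k)"
    have Yc: "Y \<in> carrier_mat n n"
      using Y by (simp add: sdp_dual_feasible_set_def psd_mat_def sym_mat_def)
    have psdY: "psd_on N (\<lambda>p. Y $$ p)"
      using Y psd_mat_iff_psd_on[OF Yc] by (simp add: sdp_dual_feasible_set_def)
    have ipA: "entry_ip N (\<lambda>p. A k $$ p) (\<lambda>p. Y $$ p) = c $ k" if "k < m" for k
      using mat_ip_eq_entry_ip[OF A_carrier[OF that] Yc psd_on_sym[OF psdY]] Y that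
      by (simp add: sdp_dual_feasible_set_def)
    have ipW: "entry_ip N (W y) (\<lambda>p. Y $$ p) = (\<Sum>k<m. c $ k * y k)" for y
      by (simp add: entry_ip_W ipA mult.commute)
    have "mat_ip B Y = entry_ip N (\<lambda>p. B $$ p) (\<lambda>p. Y $$ p)"
      by (rule mat_ip_eq_entry_ip[OF B_carrier Yc psd_on_sym[OF psdY]])
    also have "\<dots> = entry_ip N (\<lambda>p. Zf p + W x0 p) (\<lambda>p. Y $$ p)"
      by (rule entry_ip_cong) (use x0 in auto)
    also have "\<dots> = entry_ip N Zf (\<lambda>p. Y $$ p) + (\<Sum>k<m. c $ k * x0 k)"
      by (simp add: ipW)
    \<comment> \<open>Equal values leave no room for a gap, so \<open>Y\<close> is orthogonal to
      \<open>Z\<close>: the leading block of \<open>Y\<close> has trace zero, and with it rows and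
      columns \<open>R\<close> of \<open>Y\<close> vanish.\<close>
    finally have "entry_ip N Zf (\<lambda>p. Y $$ p) = 0" using eq by simp
    moreover have "entry_ip N Zf (\<lambda>p. Y $$ p) = entry_ip R id_entries (\<lambda>p. Y $$ p)"
      unfolding entry_ip_def Zf_def by (rule sum.mono_neutral_cong_right) (use r_le in auto)
    ultimately have "(\<Sum>a<r. Y $$ (a, a)) = 0"
      by (simp add: entry_ip_commute[of R id_entries] entry_ip_id)
    moreover have diag: "0 \<le> Y $$ (a, a)" if "a < r" for a
      using psd_on_diag_nonneg[OF _ psdY, of a] that r_le by simp
    ultimately have diag0: "Y $$ (a, a) = 0" if "a < r" for a
      using sum_nonneg_eq_0_iff[of R "\<lambda>a. Y $$ (a, a)"] that by auto
    have row0: "Y $$ (a, b) = 0" if "a < r" "b < n" for a b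
      using psd_on_zero_diag[OF _ psdY _ diag0] that r_le by simp
    have Y0: "Y $$ (a, b) = 0" if "a < n" "b < n" "(a, b) \<notin> Q \<times> Q" for a b
      using row0[of a b] row0[of b a] symmetric_onD[OF psd_on_sym[OF psdY], of a b] that by auto
    have off: "W x p * Y $$ p = 0" if "p \<in> N \<times> N - Q \<times> Q" for p
      using that Y0[of "fst p" "snd p"] by (cases p) auto
    have "entry_ip N (W x) (\<lambda>p. Y $$ p) = entry_ip Q (W x) (\<lambda>p. Y $$ p)"
      unfolding entry_ip_def by (rule sum.mono_neutral_right[OF _ _ ballI[OF off]]) auto
    also have "\<dots> \<ge> 0"
      by (rule entry_ip_psd_nonneg[OF _ psd psd_on_subset[OF _ _ psdY]]) auto
    \<comment> \<open>\<open>Y\<close> and \<open>Yf\<close> induce the same objective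
      \<open>c\<close>, hence agree against every linear combination.\<close>
    finally have "0 \<le> entry_ip N (W x) Yf" unfolding ipW cx .
    moreover have "entry_ip N (W x) Yf < 0"
    proof -
      have "0 < (\<Sum>p\<in>N \<times> N. - (W x p * Yf p))"
        by (rule sum_pos2[of _ "(i, j)"]) (use nz r_le in \<open>auto simp: Yf_def zero_less_mult_iff\<close>)
      then show ?thesis by (simp add: entry_ip_def sum_negf)
    qed
    ultimately show False by linarith
  qed
  moreover have "c \<in> carrier_vec m" by (simp add: c_def)
  ultimately show ?thesis unfolding badly_behaved_def by (intro bexI[of _ c]) (auto simp: val)
qed

section \<open>Translation between block matrices and index sets\<close>

lemma block_conditions:
  assumes V12: "V12 \<in> carrier_mat r (n - r)" and V22: "V22 \<in> carrier_mat (n - r) (n - r)"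
    and V11: "V11 \<in> carrier_mat r r"
    and eq: "mat_lincomb n m A v = four_block_mat V11 V12 (V12\<^sup>T) V22"
  shows "psd_mat (n - r) V22 \<longleftrightarrow> psd_on Q (W (($) v))"
    and "\<And>i j. i < r \<Longrightarrow> j < n - r \<Longrightarrow> V12 $$ (i, j) = W (($) v) (i, j + r)"
    and "\<And>i j. i < n - r \<Longrightarrow> j < n - r \<Longrightarrow> V22 $$ (i, j) = W (($) v) (i + r, j + r)"
proof -
  have idx: "W (($) v) (a, b) = four_block_mat V11 V12 (V12\<^sup>T) V22 $$ (a, b)" if "a < n" "b < n" for a b
    using mat_lincomb_index[of "(a, b)" v] that eq by simp
  show "V12 $$ (i, j) = W (($) v) (i, j + r)" if "i < r" "j < n - r" for i j
    using idx[of i "j + r"] that r_le V11 V12 V22 by simp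
  show V22_index: "V22 $$ (i, j) = W (($) v) (i + r, j + r)" if "i < n - r" "j < n - r" for i j
    using idx[of "i + r" "j + r"] that r_le V11 V12 V22 by simp
  have Q: "Q = (\<lambda>i. i + r) ` {..<n - r}"
  proof (rule subset_antisym)
    show "Q \<subseteq> (\<lambda>i. i + r) ` {..<n - r}"
    proof
      fix l assume "l \<in> Q"
      then show "l \<in> (\<lambda>i. i + r) ` {..<n - r}" by (intro image_eqI[of _ _ "l - r"]) auto
    qed
  qed auto
  have "psd_on Q (W (($) v)) \<longleftrightarrow> psd_on {..<n - r} (\<lambda>(i, j). W (($) v) (i + r, j + r))"
    unfolding Q by (rule psd_on_reindex) simp
  also have "\<dots> \<longleftrightarrow> psd_on {..<n - r} (\<lambda>p. V22 $$ p)"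
    by (intro iffI; erule psd_on_cong[rotated]) (simp_all add: V22_index)
  finally show "psd_mat (n - r) V22 \<longleftrightarrow> psd_on Q (W (($) v))"
    unfolding psd_mat_iff_psd_on[OF V22] ..
qed

lemma badly_behaved_if_certificate:
  assumes V12: "V12 \<in> carrier_mat r (n - r)" and V22: "V22 \<in> carrier_mat (n - r) (n - r)"
    and V11: "V11 \<in> carrier_mat r r"
    and eq: "mat_lincomb n m A v = four_block_mat V11 V12 (V12\<^sup>T) V22"
    and psd: "psd_mat (n - r) V22"
    and range: "\<not> mat_range (n - r) (V12\<^sup>T) \<subseteq> mat_range (n - r) V22"
  shows "badly_behaved n m A B"
proof -
  note blk = block_conditions[OF V12 V22 V11 eq]
  interpret vec_space "TYPE(real)" "n - r" .
  \<comment> \<open>If \<open>V12\<close> vanished, its transpose would have range zero, which is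
    contained in every range.\<close>
  have "\<exists>i<r. \<exists>j<n - r. V12 $$ (i, j) \<noteq> 0"
  proof (rule ccontr)
    assume "\<not> ?thesis"
    then have "V12 = 0\<^sub>m r (n - r)" using V12 by (intro eq_matI) auto
    then have "V12\<^sup>T = 0\<^sub>m (n - r) r" by simp
    then have "mat_range (n - r) (V12\<^sup>T) \<subseteq> {0\<^sub>v (n - r)}"
      using col_space_eq[of "0\<^sub>m (n - r) r" r] by auto
    moreover have "0\<^sub>v (n - r) \<in> mat_range (n - r) V22"
      unfolding col_space_eq[OF V22] using V22
      by (auto intro!: bexI[of _ "0\<^sub>v (n - r)"])
    ultimately show False using range by blast
  qed
  then obtain i j where "i < r" "j < n - r" "V12 $$ (i, j) \<noteq> 0" by blast
  then show ?thesis
    using badly_behaved_if_offdiag[of "($) v" i "j + r"] blk(1,2) psd by auto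
qed

lemma certificate_if_badly_behaved:
  assumes bad: "badly_behaved n m A B"
  shows "\<exists>v\<in>carrier_vec m. \<exists>V11\<in>carrier_mat r r. \<exists>V12\<in>carrier_mat r (n - r).
      \<exists>V22\<in>carrier_mat (n - r) (n - r).
        mat_lincomb n m A v = four_block_mat V11 V12 (V12\<^sup>T) V22 \<and>
        psd_mat (n - r) V22 \<and>
        \<not> mat_range (n - r) (V12\<^sup>T) \<subseteq> mat_range (n - r) V22"
proof (rule ccontr)
  assume no_cert: "\<not> ?thesis"
  obtain c pv where c: "sdp_primal_value n m A B c = ereal pv"
    "\<not> (\<exists>Y\<in>sdp_dual_feasible_set n m A c. ereal (mat_ip B Y) = sdp_primal_value n m A B c)"
    using bad unfolding badly_behaved_def by (metis abs_ereal.simps(2,3) ereal_cases)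
  have "\<exists>K. \<forall>i\<in>R. \<forall>j\<in>Q. W x (i, j) = (\<Sum>l\<in>Q. K i l * W x (l, j))" if psd: "psd_on Q (W x)" for x
  proof -
    define v where "v = vec m x"
    have Wv: "W (($) v) = W x" by (simp add: v_def W_vec)
    define V11 where "V11 = mat r r (W x)"
    define V12 where "V12 = mat r (n - r) (\<lambda>(i, j). W x (i, j + r))"
    define V22 where "V22 = mat (n - r) (n - r) (\<lambda>(i, j). W x (i + r, j + r))"
    have V11: "V11 \<in> carrier_mat r r" and V12: "V12 \<in> carrier_mat r (n - r)"
      and V22: "V22 \<in> carrier_mat (n - r) (n - r)"
      by (simp_all add: V11_def V12_def V22_def)
    have eq: "mat_lincomb n m A v = four_block_mat V11 V12 (V12\<^sup>T) V22"
    proof (rule eq_matI)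
      fix a b assume "a < dim_row (four_block_mat V11 V12 (V12\<^sup>T) V22)"
        "b < dim_col (four_block_mat V11 V12 (V12\<^sup>T) V22)"
      then have ab: "a < n" "b < n" using V11 V22 r_le by auto
      then show "mat_lincomb n m A v $$ (a, b) = four_block_mat V11 V12 (V12\<^sup>T) V22 $$ (a, b)"
        using mat_lincomb_index[of "(a, b)" v] symmetric_onD[OF W_symmetric_on, of a b x]
        by (auto simp: Wv V11_def V12_def V22_def)
    qed (use V11 V22 r_le in \<open>auto simp: mat_lincomb_def\<close>)
    note blk = block_conditions[OF V12 V22 V11 eq, unfolded Wv]
    have "psd_mat (n - r) V22" using blk(1) psd by blast
    moreover have "v \<in> carrier_vec m" by (simp add: v_def)
    ultimately have range: "mat_range (n - r) (V12\<^sup>T) \<subseteq> mat_range (n - r) V22"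
      using no_cert V11 V12 V22 eq by blast
    interpret vec_space "TYPE(real)" "n - r" .
    \<comment> \<open>Row \<open>i\<close> of \<open>V12\<close> is a column of its transpose, so
      the range inclusion provides a preimage under \<open>V22\<close>. These preimages, reindexed
      by \<open>r\<close>, are the rows of \<open>K\<close>.\<close>
    have "\<exists>k\<in>carrier_vec (n - r). V22 *\<^sub>v k = row V12 i" if "i < r" for i
    proof -
      have V12T: "V12\<^sup>T \<in> carrier_mat (n - r) r" using V12 by simp
      have "col (V12\<^sup>T) i \<in> set (cols (V12\<^sup>T))" using V12 that by (auto simp: cols_def)
      then have "col (V12\<^sup>T) i \<in> mat_range (n - r) (V12\<^sup>T)"
        unfolding col_space_def using V12T cols_dim[of "V12\<^sup>T"] by (intro span_mem) auto
      then have "row V12 i \<in> mat_range (n - r) V22" using range V12 that by auto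
      then show ?thesis unfolding col_space_eq[OF V22] using V22 by auto
    qed
    then obtain k where k: "\<And>i. i < r \<Longrightarrow> k i \<in> carrier_vec (n - r)"
      "\<And>i. i < r \<Longrightarrow> V22 *\<^sub>v k i = row V12 i" by metis
    have "W x (i, j) = (\<Sum>l\<in>Q. k i $ (l - r) * W x (l, j))" if i: "i \<in> R" and j: "j \<in> Q" for i j
    proof -
      have j': "j - r < n - r" using j by auto
      have "W x (i, j) = row V12 i $ (j - r)" using i j V12 by (auto simp: V12_def)
      also have "\<dots> = (V22 *\<^sub>v k i) $ (j - r)" using k(2) i by simp
      also have "\<dots> = (\<Sum>l<n - r. W x (j, l + r) * k i $ l)"
        using V22 j' k(1)[of i] i j blk(3)
        by (auto simp: scalar_prod_def lessThan_atLeast0 intro!: sum.cong)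
      \<comment> \<open>The shift by \<open>r\<close> returns to the indices in \<open>Q\<close>,
        and symmetry exchanges row \<open>j\<close> of the trailing block for column
        \<open>j\<close>.\<close>
      also have "\<dots> = (\<Sum>l\<in>Q. k i $ (l - r) * W x (l, j))"
        by (rule sum.reindex_bij_witness[where i = "\<lambda>l. l - r" and j = "\<lambda>l. l + r"])
          (use j symmetric_onD[OF W_symmetric_on] in auto)
      finally show ?thesis .
    qed
    then show ?thesis by (intro exI[of _ "\<lambda>i l. k i $ (l - r)"]) blast
  qed
  from dual_attained[OF this c(1)] c show False by auto
qed

end

theorem theorem1:
  fixes n m r :: nat and A :: "nat \<Rightarrow> real mat" and B :: "real mat"
  assumes A_sym: "\<forall>i<m. sym_mat n (A i)"
    and B_sym: "sym_mat n B"
    and feas: "sdp_feasible n m A B"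
    and r_le: "r \<le> n"
    and Z_max: "is_max_rank_slack n m A B
      (four_block_mat (1\<^sub>m r) (0\<^sub>m r (n - r)) (0\<^sub>m (n - r) r) (0\<^sub>m (n - r) (n - r)))"
  shows "badly_behaved n m A B \<longleftrightarrow>
    (\<exists>v\<in>carrier_vec m. \<exists>V11\<in>carrier_mat r r. \<exists>V12\<in>carrier_mat r (n - r).
      \<exists>V22\<in>carrier_mat (n - r) (n - r).
        mat_lincomb n m A v = four_block_mat V11 V12 (transpose_mat V12) V22 \<and>
        psd_mat (n - r) V22 \<and>
        \<not> mat_range (n - r) (transpose_mat V12) \<subseteq> mat_range (n - r) V22)"
proof -
  interpret max_rank_slack_block n m r A B
    using assms by unfold_locales auto
  show ?thesis
    using certificate_if_badly_behaved badly_behaved_if_certificate by blast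
qed

end
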